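(* Let $S$ be a totally ordered idempotent semifield, $M$ a finitely generated $\mathbb{F}_1$-module (i.e. a finite pointed set), and $f\in M\otimes S$. The canonical map from the $S$-module $(M\otimes S)/\mathcal{B}(f)$ to its double dual is an isomorphism; in particular, there is a canonical isomorphism $\operatorname{bend}(f)^\vee\cong(M\otimes S)/\mathcal{B}(f)$.
   Context: All semirings are commutative with unit. $S$ is idempotent if $a+a=a$ for all $a$; then $a\le b\iff a+b=b$ is a partial order, and $S$ is totally ordered if this is a total order. A semifield is a semiring in which every nonzero element is invertible. For a pointed set $M$ with basepoint $0_M$, $M\otimes S$ is the free $S$-module on $M\setminus\{0_M\}$; $\operatorname{supp}(f)\subset M$ is the set of basis elements occurring in $f$ with nonzero coefficient. For $m\in\operatorname{supp}(f)$, $f_{\widehat m}$ is $f$ with its $m$-term deleted. An $S$-module congruence on a module $V$ is an equivalence relation that is an $S$-submodule of $V\times V$; $V/J$ is the quotient module. $\mathcal{B}(f)$ is the $S$-module congruence on $M\otimes S$ generated by the bend relations $f\sim f_{\widehat m}$, $m\in\operatorname{supp}(f)$. For an $S$-module $V$, $V^\vee=\operatorname{Hom}_S(V,S)$ with its natural $S$-module structure. The set-theoretic bend locus is $\operatorname{bend}(f)=\big((M\otimes S)/\mathcal{B}(f)\big)^\vee$, a submodule of $(M\otimes S)^\vee$. *)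

theory Defs
  imports "HOL-Algebra.Module" "HOL-Algebra.AbelCoset"
begin

section \<open>Totally ordered idempotent semifields\<close>

locale csemiring = semiring S + comm_monoid S for S (structure)

text \<open>A semifield only has to invert its nonzero elements: \<open>\<zero> \<noteq> \<one>\<close> is not required,
  so the one-element semiring is not excluded.\<close>

locale idempotent_csemiring = csemiring +
  assumes add_idem: "a \<in> carrier S \<Longrightarrow> a \<oplus> a = a"

locale csemifield = csemiring +
  assumes nonzero_Units: "a \<in> carrier S \<Longrightarrow> a \<noteq> \<zero> \<Longrightarrow> a \<in> Units S"

definition natural_order :: "('a, 'x) ring_scheme \<Rightarrow> ('a \<times> 'a) set" where
  "natural_order S = {(a, b). a \<in> carrier S \<and> b \<in> carrier S \<and> a \<oplus>\<^bsub>S\<^esub> b = b}"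

locale totally_ordered_idempotent_semifield = idempotent_csemiring + csemifield +
  assumes linear_natural_order: "linear_order_on (carrier S) (natural_order S)"


section \<open>Modules over a commutative semiring\<close>

text \<open>The library locale \<^locale>\<open>module\<close> requires additive inverses, so the axioms are repeated
  over a semiring; the two null laws are no longer consequences of the others.  The record type
  is the one of the library, whose multiplicative components \<^const>\<open>mult\<close> and \<^const>\<open>one\<close> play no role
  for modules and are left undefined.\<close>

locale semimodule = S?: csemiring S + V?: abelian_monoid V
  for S (structure) and V (structure) +
  assumes smult_closed:
      "a \<in> carrier S \<Longrightarrow> x \<in> carrier V \<Longrightarrow> a \<odot>\<^bsub>V\<^esub> x \<in> carrier V"
    and smult_l_distr:
      "a \<in> carrier S \<Longrightarrow> b \<in> carrier S \<Longrightarrow> x \<in> carrier V \<Longrightarrow>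
        (a \<oplus>\<^bsub>S\<^esub> b) \<odot>\<^bsub>V\<^esub> x = a \<odot>\<^bsub>V\<^esub> x \<oplus>\<^bsub>V\<^esub> b \<odot>\<^bsub>V\<^esub> x"
    and smult_r_distr:
      "a \<in> carrier S \<Longrightarrow> x \<in> carrier V \<Longrightarrow> y \<in> carrier V \<Longrightarrow>
        a \<odot>\<^bsub>V\<^esub> (x \<oplus>\<^bsub>V\<^esub> y) = a \<odot>\<^bsub>V\<^esub> x \<oplus>\<^bsub>V\<^esub> a \<odot>\<^bsub>V\<^esub> y"
    and smult_assoc1:
      "a \<in> carrier S \<Longrightarrow> b \<in> carrier S \<Longrightarrow> x \<in> carrier V \<Longrightarrow>
        (a \<otimes>\<^bsub>S\<^esub> b) \<odot>\<^bsub>V\<^esub> x = a \<odot>\<^bsub>V\<^esub> (b \<odot>\<^bsub>V\<^esub> x)"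
    and smult_one: "x \<in> carrier V \<Longrightarrow> \<one>\<^bsub>S\<^esub> \<odot>\<^bsub>V\<^esub> x = x"
    and smult_l_null: "x \<in> carrier V \<Longrightarrow> \<zero>\<^bsub>S\<^esub> \<odot>\<^bsub>V\<^esub> x = \<zero>\<^bsub>V\<^esub>"
    and smult_r_null: "a \<in> carrier S \<Longrightarrow> a \<odot>\<^bsub>V\<^esub> \<zero>\<^bsub>V\<^esub> = \<zero>\<^bsub>V\<^esub>"

definition subsemimodule ::
    "('a, 'x) ring_scheme \<Rightarrow> ('a, 'v, 'y) module_scheme \<Rightarrow> 'v set \<Rightarrow> bool" where
  "subsemimodule S V H \<longleftrightarrow>
     H \<subseteq> carrier V \<and> \<zero>\<^bsub>V\<^esub> \<in> H \<and>
     (\<forall>x\<in>H. \<forall>y\<in>H. x \<oplus>\<^bsub>V\<^esub> y \<in> H) \<and>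
     (\<forall>a\<in>carrier S. \<forall>x\<in>H. a \<odot>\<^bsub>V\<^esub> x \<in> H)"

definition prod_semimodule ::
    "('a, 'v, 'y) module_scheme \<Rightarrow> ('a, 'w, 'z) module_scheme \<Rightarrow> ('a, 'v \<times> 'w) module" where
  "prod_semimodule V W =
     \<lparr>carrier = carrier V \<times> carrier W, mult = undefined, one = undefined,
      zero = (\<zero>\<^bsub>V\<^esub>, \<zero>\<^bsub>W\<^esub>),
      add = (\<lambda>(x, x') (y, y'). (x \<oplus>\<^bsub>V\<^esub> y, x' \<oplus>\<^bsub>W\<^esub> y')),
      smult = (\<lambda>a (x, x'). (a \<odot>\<^bsub>V\<^esub> x, a \<odot>\<^bsub>W\<^esub> x'))\<rparr>"

definition semimodule_hom ::
    "('a, 'x) ring_scheme \<Rightarrow> ('a, 'v, 'y) module_scheme \<Rightarrow> ('a, 'w, 'z) module_scheme \<Rightarrow>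
      ('v \<Rightarrow> 'w) set" where
  "semimodule_hom S V W =
     {h \<in> carrier V \<rightarrow> carrier W.
        h \<zero>\<^bsub>V\<^esub> = \<zero>\<^bsub>W\<^esub> \<and>
        (\<forall>x\<in>carrier V. \<forall>y\<in>carrier V. h (x \<oplus>\<^bsub>V\<^esub> y) = h x \<oplus>\<^bsub>W\<^esub> h y) \<and>
        (\<forall>a\<in>carrier S. \<forall>x\<in>carrier V. h (a \<odot>\<^bsub>V\<^esub> x) = a \<odot>\<^bsub>W\<^esub> h x)}"

definition semimodule_iso ::
    "('a, 'x) ring_scheme \<Rightarrow> ('a, 'v, 'y) module_scheme \<Rightarrow> ('a, 'w, 'z) module_scheme \<Rightarrow>
      ('v \<Rightarrow> 'w) set" where
  "semimodule_iso S V W = {h \<in> semimodule_hom S V W. bij_betw h (carrier V) (carrier W)}"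

definition self_semimodule :: "('a, 'x) ring_scheme \<Rightarrow> ('a, 'a) module" where
  "self_semimodule S =
     \<lparr>carrier = carrier S, mult = undefined, one = undefined, zero = \<zero>\<^bsub>S\<^esub>,
      add = add S, smult = mult S\<rparr>"

text \<open>Linear forms are required to be \<^const>\<open>undefined\<close> outside the carrier, so that
  equality of elements of the dual is equality of functions on the carrier.\<close>

definition dual ::
    "('a, 'x) ring_scheme \<Rightarrow> ('a, 'v, 'y) module_scheme \<Rightarrow> ('a, 'v \<Rightarrow> 'a) module" where
  "dual S V =
     \<lparr>carrier = semimodule_hom S V (self_semimodule S) \<inter> extensional (carrier V),
      mult = undefined, one = undefined,
      zero = (\<lambda>x\<in>carrier V. \<zero>\<^bsub>S\<^esub>),
      add = (\<lambda>\<phi> \<psi>. \<lambda>x\<in>carrier V. \<phi> x \<oplus>\<^bsub>S\<^esub> \<psi> x),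
      smult = (\<lambda>a \<phi>. \<lambda>x\<in>carrier V. a \<otimes>\<^bsub>S\<^esub> \<phi> x)\<rparr>"

definition double_dual_map ::
    "('a, 'x) ring_scheme \<Rightarrow> ('a, 'v, 'y) module_scheme \<Rightarrow> 'v \<Rightarrow> ('v \<Rightarrow> 'a) \<Rightarrow> 'a" where
  "double_dual_map S V x = (\<lambda>\<phi>\<in>carrier (dual S V). \<phi> x)"

definition semimodule_congruence ::
    "('a, 'x) ring_scheme \<Rightarrow> ('a, 'v, 'y) module_scheme \<Rightarrow> ('v \<times> 'v) set \<Rightarrow> bool" where
  "semimodule_congruence S V J \<longleftrightarrow>
     equiv (carrier V) J \<and> subsemimodule S (prod_semimodule V V) J"

definition generated_congruence ::
    "('a, 'x) ring_scheme \<Rightarrow> ('a, 'v, 'y) module_scheme \<Rightarrow> ('v \<times> 'v) set \<Rightarrow> ('v \<times> 'v) set" where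
  "generated_congruence S V R = \<Inter>{J. semimodule_congruence S V J \<and> R \<subseteq> J}"

text \<open>The sum of two classes is the class that contains all sums of representatives, and
  similarly for multiples.\<close>

definition quotient_semimodule ::
    "('a, 'v, 'y) module_scheme \<Rightarrow> ('v \<times> 'v) set \<Rightarrow> ('a, 'v set) module" where
  "quotient_semimodule V J =
     \<lparr>carrier = carrier V // J, mult = undefined, one = undefined,
      zero = J `` {\<zero>\<^bsub>V\<^esub>},
      add = (\<lambda>A B. J `` (A <+>\<^bsub>V\<^esub> B)),
      smult = (\<lambda>a A. J `` ((\<lambda>x. a \<odot>\<^bsub>V\<^esub> x) ` A))\<rparr>"


section \<open>Free modules on pointed sets and bend loci\<close>

text \<open>A pointed set is a set \<open>M\<close> together with a basepoint \<open>p \<in> M\<close>.  An element of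
  \<open>M \<otimes> S\<close> is its family of coefficients, indexed by \<open>M - {p}\<close>.\<close>

definition supp :: "('a, 'x) ring_scheme \<Rightarrow> 'm set \<Rightarrow> 'm \<Rightarrow> ('m \<Rightarrow> 'a) \<Rightarrow> 'm set" where
  "supp S M p f = {m \<in> M - {p}. f m \<noteq> \<zero>\<^bsub>S\<^esub>}"

definition free_semimodule ::
    "('a, 'x) ring_scheme \<Rightarrow> 'm set \<Rightarrow> 'm \<Rightarrow> ('a, 'm \<Rightarrow> 'a) module" where
  "free_semimodule S M p =
     \<lparr>carrier = {v \<in> M - {p} \<rightarrow>\<^sub>E carrier S. finite (supp S M p v)},
      mult = undefined, one = undefined,
      zero = (\<lambda>m\<in>M - {p}. \<zero>\<^bsub>S\<^esub>),
      add = (\<lambda>u v. \<lambda>m\<in>M - {p}. u m \<oplus>\<^bsub>S\<^esub> v m),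
      smult = (\<lambda>a v. \<lambda>m\<in>M - {p}. a \<otimes>\<^bsub>S\<^esub> v m)\<rparr>"

definition delete_term :: "('a, 'x) ring_scheme \<Rightarrow> ('m \<Rightarrow> 'a) \<Rightarrow> 'm \<Rightarrow> 'm \<Rightarrow> 'a" where
  "delete_term S f m = f(m := \<zero>\<^bsub>S\<^esub>)"

definition bend_relations ::
    "('a, 'x) ring_scheme \<Rightarrow> 'm set \<Rightarrow> 'm \<Rightarrow> ('m \<Rightarrow> 'a) \<Rightarrow> (('m \<Rightarrow> 'a) \<times> ('m \<Rightarrow> 'a)) set" where
  "bend_relations S M p f = {(f, delete_term S f m) | m. m \<in> supp S M p f}"

definition bend_congruence ::
    "('a, 'x) ring_scheme \<Rightarrow> 'm set \<Rightarrow> 'm \<Rightarrow> ('m \<Rightarrow> 'a) \<Rightarrow> (('m \<Rightarrow> 'a) \<times> ('m \<Rightarrow> 'a)) set" where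
  "bend_congruence S M p f =
     generated_congruence S (free_semimodule S M p) (bend_relations S M p f)"

definition bend_quotient ::
    "('a, 'x) ring_scheme \<Rightarrow> 'm set \<Rightarrow> 'm \<Rightarrow> ('m \<Rightarrow> 'a) \<Rightarrow> ('a, ('m \<Rightarrow> 'a) set) module" where
  "bend_quotient S M p f = quotient_semimodule (free_semimodule S M p) (bend_congruence S M p f)"

text \<open>The dual of \<open>(M \<otimes> S) / \<B>(f)\<close> is a submodule of the dual of \<open>M \<otimes> S\<close> by composition
  with the quotient map, and the bend locus is this submodule; the lemma
  \<open>bend_pullback_iso\<close> below identifies it with the dual of the quotient.\<close>

definition bend_pullback ::
    "('a, 'x) ring_scheme \<Rightarrow> 'm set \<Rightarrow> 'm \<Rightarrow> ('m \<Rightarrow> 'a) \<Rightarrow>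
      (('m \<Rightarrow> 'a) set \<Rightarrow> 'a) \<Rightarrow> ('m \<Rightarrow> 'a) \<Rightarrow> 'a" where
  "bend_pullback S M p f \<phi> =
     (\<lambda>v\<in>carrier (free_semimodule S M p). \<phi> (bend_congruence S M p f `` {v}))"

definition bend ::
    "('a, 'x) ring_scheme \<Rightarrow> 'm set \<Rightarrow> 'm \<Rightarrow> ('m \<Rightarrow> 'a) \<Rightarrow> ('a, ('m \<Rightarrow> 'a) \<Rightarrow> 'a) module" where
  "bend S M p f = (dual S (free_semimodule S M p))
     \<lparr>carrier := bend_pullback S M p f ` carrier (dual S (bend_quotient S M p f))\<rparr>"

text \<open>The linear forms in the bend locus are constant on the classes of \<open>\<B>(f)\<close>; evaluation of
  such a form at a class is its value there.\<close>

definition bend_evaluation ::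
    "('a, 'x) ring_scheme \<Rightarrow> 'm set \<Rightarrow> 'm \<Rightarrow> ('m \<Rightarrow> 'a) \<Rightarrow>
      ('m \<Rightarrow> 'a) set \<Rightarrow> (('m \<Rightarrow> 'a) \<Rightarrow> 'a) \<Rightarrow> 'a" where
  "bend_evaluation S M p f A = (\<lambda>\<psi>\<in>carrier (bend S M p f). the_elem (\<psi> ` A))"


section \<open>Basic facts\<close>

lemma (in csemiring) free_semimodule:
  "semimodule S (free_semimodule S M p)"
proof -
  let ?F = "free_semimodule S M p"
  have fin_add: "finite (supp S M p (\<lambda>m\<in>M - {p}. u m \<oplus> v m))"
    if "finite (supp S M p u)" "finite (supp S M p v)" for u v
    by (rule finite_subset[OF _ finite_UnI[OF that]]) (auto simp: supp_def)
  have fin_smult: "finite (supp S M p (\<lambda>m\<in>M - {p}. a \<otimes> v m))"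
    if "finite (supp S M p v)" "a \<in> carrier S" for a v
    by (rule finite_subset[OF _ that(1)]) (use that(2) in \<open>auto simp: supp_def\<close>)
  have "supp S M p (\<lambda>m\<in>M - {p}. \<zero>) = {}"
    by (auto simp: supp_def)
  then have fin_zero: "finite (supp S M p (\<lambda>m\<in>M - {p}. \<zero>))"
    by simp
  have carr: "v m \<in> carrier S" if "v \<in> carrier ?F" "m \<in> M - {p}" for v m
    using that PiE_mem[of v "M - {p}" "\<lambda>_. carrier S"] by (simp add: free_semimodule_def)
  have ext: "(\<lambda>m\<in>M - {p}. g m) = v"
    if "v \<in> carrier ?F" "\<And>m. m \<in> M - {p} \<Longrightarrow> g m = v m" for v g
    using that by (intro extensionalityI[of _ "M - {p}"]) (auto simp: free_semimodule_def PiE_def)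
  have add_closed: "u \<oplus>\<^bsub>?F\<^esub> v \<in> carrier ?F" if "u \<in> carrier ?F" "v \<in> carrier ?F" for u v
    using that carr[OF that(1)] carr[OF that(2)] by (simp add: free_semimodule_def fin_add)
  have smult_closed: "a \<odot>\<^bsub>?F\<^esub> v \<in> carrier ?F" if "a \<in> carrier S" "v \<in> carrier ?F" for a v
    using that carr[OF that(2)] by (simp add: free_semimodule_def fin_smult)
  have zero_closed: "\<zero>\<^bsub>?F\<^esub> \<in> carrier ?F"
    by (simp add: free_semimodule_def fin_zero)
  have add: "u \<oplus>\<^bsub>?F\<^esub> v = (\<lambda>m\<in>M - {p}. u m \<oplus> v m)"
    and smult: "a \<odot>\<^bsub>?F\<^esub> v = (\<lambda>m\<in>M - {p}. a \<otimes> v m)"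
    and zero: "\<zero>\<^bsub>?F\<^esub> = (\<lambda>m\<in>M - {p}. \<zero>)" for u v a
    by (simp_all add: free_semimodule_def)
  have ab: "abelian_monoid ?F"
  proof (rule abelian_monoidI)
    fix u v w
    assume u: "u \<in> carrier ?F" and v: "v \<in> carrier ?F" and w: "w \<in> carrier ?F"
    show "u \<oplus>\<^bsub>?F\<^esub> v \<oplus>\<^bsub>?F\<^esub> w = u \<oplus>\<^bsub>?F\<^esub> (v \<oplus>\<^bsub>?F\<^esub> w)"
      unfolding add using carr[OF u] carr[OF v] carr[OF w]
      by (intro restrict_ext) (simp add: a_assoc)
  next
    fix u v
    assume u: "u \<in> carrier ?F" and v: "v \<in> carrier ?F"
    show "u \<oplus>\<^bsub>?F\<^esub> v = v \<oplus>\<^bsub>?F\<^esub> u"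
      unfolding add using carr[OF u] carr[OF v] by (intro restrict_ext a_comm)
    show "u \<oplus>\<^bsub>?F\<^esub> v \<in> carrier ?F" using u v by (rule add_closed)
  next
    fix u
    assume u: "u \<in> carrier ?F"
    show "\<zero>\<^bsub>?F\<^esub> \<oplus>\<^bsub>?F\<^esub> u = u"
      unfolding add zero using carr[OF u] by (intro ext[OF u]) simp
  qed (rule zero_closed)
  have ld: "(a \<oplus> b) \<odot>\<^bsub>?F\<^esub> u = a \<odot>\<^bsub>?F\<^esub> u \<oplus>\<^bsub>?F\<^esub> b \<odot>\<^bsub>?F\<^esub> u"
    if "a \<in> carrier S" "b \<in> carrier S" "u \<in> carrier ?F" for a b u
    unfolding add smult using that carr[OF that(3)] by (intro restrict_ext) (simp add: l_distr)
  have rd: "a \<odot>\<^bsub>?F\<^esub> (u \<oplus>\<^bsub>?F\<^esub> v) = a \<odot>\<^bsub>?F\<^esub> u \<oplus>\<^bsub>?F\<^esub> a \<odot>\<^bsub>?F\<^esub> v"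
    if "a \<in> carrier S" "u \<in> carrier ?F" "v \<in> carrier ?F" for a u v
    unfolding add smult using that carr[OF that(2)] carr[OF that(3)]
    by (intro restrict_ext) (simp add: r_distr)
  have as: "(a \<otimes> b) \<odot>\<^bsub>?F\<^esub> u = a \<odot>\<^bsub>?F\<^esub> (b \<odot>\<^bsub>?F\<^esub> u)"
    if "a \<in> carrier S" "b \<in> carrier S" "u \<in> carrier ?F" for a b u
    unfolding smult using that carr[OF that(3)] by (intro restrict_ext) (simp add: m_assoc)
  have on: "\<one> \<odot>\<^bsub>?F\<^esub> u = u" if "u \<in> carrier ?F" for u
    unfolding smult using carr[OF that] by (intro ext[OF that]) simp
  have ln: "\<zero> \<odot>\<^bsub>?F\<^esub> u = \<zero>\<^bsub>?F\<^esub>" if "u \<in> carrier ?F" for u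
    unfolding smult zero using carr[OF that] by (intro restrict_ext) simp
  have rn: "a \<odot>\<^bsub>?F\<^esub> \<zero>\<^bsub>?F\<^esub> = \<zero>\<^bsub>?F\<^esub>" if "a \<in> carrier S" for a
    unfolding smult zero using that by (intro restrict_ext) simp
  show ?thesis
    by (rule semimodule.intro[OF csemiring_axioms ab], rule semimodule_axioms.intro)
       (fact smult_closed ld rd as on ln rn)+
qed

lemma (in csemiring) dual_semimodule:
  assumes "semimodule S V"
  shows "semimodule S (dual S V)"
proof -
  interpret V: semimodule S V by fact
  let ?D = "dual S V"
  have carr: "\<phi> x \<in> carrier S" if "\<phi> \<in> carrier ?D" "x \<in> carrier V" for \<phi> x
    using that by (auto simp: dual_def semimodule_hom_def self_semimodule_def)
  have ext: "(\<lambda>x\<in>carrier V. g x) = \<phi>"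
    if "\<phi> \<in> carrier ?D" "\<And>x. x \<in> carrier V \<Longrightarrow> g x = \<phi> x" for \<phi> g
    using that by (intro extensionalityI[of _ "carrier V"]) (auto simp: dual_def)
  have form: "\<phi> \<in> carrier ?D \<longleftrightarrow> \<phi> \<in> extensional (carrier V) \<and>
      (\<forall>x\<in>carrier V. \<phi> x \<in> carrier S) \<and> \<phi> \<zero>\<^bsub>V\<^esub> = \<zero> \<and>
      (\<forall>x\<in>carrier V. \<forall>y\<in>carrier V. \<phi> (x \<oplus>\<^bsub>V\<^esub> y) = \<phi> x \<oplus> \<phi> y) \<and>
      (\<forall>a\<in>carrier S. \<forall>x\<in>carrier V. \<phi> (a \<odot>\<^bsub>V\<^esub> x) = a \<otimes> \<phi> x)" for \<phi>
    by (auto simp: dual_def semimodule_hom_def self_semimodule_def)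
  have add: "u \<oplus>\<^bsub>?D\<^esub> v = (\<lambda>x\<in>carrier V. u x \<oplus> v x)"
    and smult: "a \<odot>\<^bsub>?D\<^esub> v = (\<lambda>x\<in>carrier V. a \<otimes> v x)"
    and zero: "\<zero>\<^bsub>?D\<^esub> = (\<lambda>x\<in>carrier V. \<zero>)" for u v a
    by (simp_all add: dual_def)
  have add_closed: "u \<oplus>\<^bsub>?D\<^esub> v \<in> carrier ?D" if "u \<in> carrier ?D" "v \<in> carrier ?D" for u v
    using that unfolding form add
    by (simp add: V.smult_closed r_distr a_assoc a_comm a_lcomm)
  have smult_closed: "a \<odot>\<^bsub>?D\<^esub> v \<in> carrier ?D" if "a \<in> carrier S" "v \<in> carrier ?D" for a v
    using that unfolding form smult by (simp add: V.smult_closed r_distr m_lcomm)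
  have zero_closed: "\<zero>\<^bsub>?D\<^esub> \<in> carrier ?D"
    unfolding form zero by (simp add: V.smult_closed)
  have ab: "abelian_monoid ?D"
  proof (rule abelian_monoidI)
    fix u v w
    assume u: "u \<in> carrier ?D" and v: "v \<in> carrier ?D" and w: "w \<in> carrier ?D"
    show "u \<oplus>\<^bsub>?D\<^esub> v \<oplus>\<^bsub>?D\<^esub> w = u \<oplus>\<^bsub>?D\<^esub> (v \<oplus>\<^bsub>?D\<^esub> w)"
      unfolding add using carr[OF u] carr[OF v] carr[OF w]
      by (intro restrict_ext) (simp add: a_assoc)
  next
    fix u v
    assume u: "u \<in> carrier ?D" and v: "v \<in> carrier ?D"
    show "u \<oplus>\<^bsub>?D\<^esub> v = v \<oplus>\<^bsub>?D\<^esub> u"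
      unfolding add using carr[OF u] carr[OF v] by (intro restrict_ext a_comm)
    show "u \<oplus>\<^bsub>?D\<^esub> v \<in> carrier ?D" using u v by (rule add_closed)
  next
    fix u
    assume u: "u \<in> carrier ?D"
    show "\<zero>\<^bsub>?D\<^esub> \<oplus>\<^bsub>?D\<^esub> u = u"
      unfolding add zero using carr[OF u] by (intro ext[OF u]) simp
  qed (rule zero_closed)
  have ld: "(a \<oplus> b) \<odot>\<^bsub>?D\<^esub> u = a \<odot>\<^bsub>?D\<^esub> u \<oplus>\<^bsub>?D\<^esub> b \<odot>\<^bsub>?D\<^esub> u"
    if "a \<in> carrier S" "b \<in> carrier S" "u \<in> carrier ?D" for a b u
    unfolding add smult using that carr[OF that(3)] by (intro restrict_ext) (simp add: l_distr)
  have rd: "a \<odot>\<^bsub>?D\<^esub> (u \<oplus>\<^bsub>?D\<^esub> v) = a \<odot>\<^bsub>?D\<^esub> u \<oplus>\<^bsub>?D\<^esub> a \<odot>\<^bsub>?D\<^esub> v"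
    if "a \<in> carrier S" "u \<in> carrier ?D" "v \<in> carrier ?D" for a u v
    unfolding add smult using that carr[OF that(2)] carr[OF that(3)]
    by (intro restrict_ext) (simp add: r_distr)
  have as: "(a \<otimes> b) \<odot>\<^bsub>?D\<^esub> u = a \<odot>\<^bsub>?D\<^esub> (b \<odot>\<^bsub>?D\<^esub> u)"
    if "a \<in> carrier S" "b \<in> carrier S" "u \<in> carrier ?D" for a b u
    unfolding smult using that carr[OF that(3)] by (intro restrict_ext) (simp add: m_assoc)
  have on: "\<one> \<odot>\<^bsub>?D\<^esub> u = u" if "u \<in> carrier ?D" for u
    unfolding smult using carr[OF that] by (intro ext[OF that]) simp
  have ln: "\<zero> \<odot>\<^bsub>?D\<^esub> u = \<zero>\<^bsub>?D\<^esub>" if "u \<in> carrier ?D" for u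
    unfolding smult zero using carr[OF that] by (intro restrict_ext) simp
  have rn: "a \<odot>\<^bsub>?D\<^esub> \<zero>\<^bsub>?D\<^esub> = \<zero>\<^bsub>?D\<^esub>" if "a \<in> carrier S" for a
    unfolding smult zero using that by (intro restrict_ext) simp
  show ?thesis
    by (rule semimodule.intro[OF csemiring_axioms ab], rule semimodule_axioms.intro)
       (fact smult_closed ld rd as on ln rn)+
qed

lemma (in semimodule) semimodule_congruence_generated:
  assumes "R \<subseteq> carrier V \<times> carrier V"
  shows "semimodule_congruence S V (generated_congruence S V R)"
    and "R \<subseteq> generated_congruence S V R"
proof -
  let ?C = "{J. semimodule_congruence S V J \<and> R \<subseteq> J}"
  have total: "carrier V \<times> carrier V \<in> ?C"
    using assms
    by (auto simp: semimodule_congruence_def subsemimodule_def prod_semimodule_def smult_closed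
          equiv_def refl_on_def sym_def trans_def)
  have eqv: "equiv (carrier V) J" if "J \<in> ?C" for J
    using that by (simp add: semimodule_congruence_def)
  have "equiv (carrier V) (\<Inter>?C)"
  proof (rule equivI)
    show "\<Inter>?C \<subseteq> carrier V \<times> carrier V" using total by blast
    show "refl_on (carrier V) (\<Inter>?C)"
      using eqv by (auto simp: refl_on_def equiv_def)
    show "sym (\<Inter>?C)"
      using eqv by (auto intro!: symI simp: equiv_def dest: symD)
    show "trans (\<Inter>?C)"
    proof (intro transI InterI)
      fix x y z J
      assume xy: "(x, y) \<in> \<Inter>?C" and yz: "(y, z) \<in> \<Inter>?C" and J: "J \<in> ?C"
      have "trans J" using eqv[OF J] by (rule equivE)
      then show "(x, z) \<in> J"
        using InterD[OF xy J] InterD[OF yz J] by (rule transD)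
    qed
  qed
  moreover have "subsemimodule S (prod_semimodule V V) (\<Inter>?C)"
  proof -
    have sub: "subsemimodule S (prod_semimodule V V) J" if "J \<in> ?C" for J
      using that by (simp add: semimodule_congruence_def)
    show ?thesis
      unfolding subsemimodule_def
    proof (intro conjI ballI)
      show "\<Inter>?C \<subseteq> carrier (prod_semimodule V V)"
        using Inter_lower[OF total] by (simp add: prod_semimodule_def)
    qed (use sub in \<open>simp_all add: subsemimodule_def\<close>)
  qed
  ultimately show "semimodule_congruence S V (generated_congruence S V R)"
    unfolding generated_congruence_def semimodule_congruence_def by blast
  show "R \<subseteq> generated_congruence S V R"
    unfolding generated_congruence_def by blast
qed

context
  fixes S :: "('a, 'x) ring_scheme" and V :: "('a, 'v, 'y) module_scheme" and J
  assumes cong: "semimodule_congruence S V J"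
begin

private lemma J_equiv: "equiv (carrier V) J"
  using cong by (simp add: semimodule_congruence_def)

private lemma J_add: "(x, x') \<in> J \<Longrightarrow> (y, y') \<in> J \<Longrightarrow> (x \<oplus>\<^bsub>V\<^esub> y, x' \<oplus>\<^bsub>V\<^esub> y') \<in> J"
  using cong
  by (fastforce simp: semimodule_congruence_def subsemimodule_def prod_semimodule_def)

private lemma J_smult: "a \<in> carrier S \<Longrightarrow> (x, x') \<in> J \<Longrightarrow> (a \<odot>\<^bsub>V\<^esub> x, a \<odot>\<^bsub>V\<^esub> x') \<in> J"
  using cong
  by (fastforce simp: semimodule_congruence_def subsemimodule_def prod_semimodule_def)

lemma quotient_add:
  assumes "x \<in> carrier V" "y \<in> carrier V"
  shows "J `` {x} \<oplus>\<^bsub>quotient_semimodule V J\<^esub> J `` {y} = J `` {x \<oplus>\<^bsub>V\<^esub> y}"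
proof -
  have xy: "(x, x) \<in> J" "(y, y) \<in> J"
    using assms J_equiv by (auto simp: equiv_def refl_on_def)
  have tr: "(u, w) \<in> J" if "(u, v) \<in> J" "(v, w) \<in> J" for u v w
    using J_equiv that by (meson equivE transD)
  have "J `` (J `` {x} <+>\<^bsub>V\<^esub> J `` {y}) = J `` {x \<oplus>\<^bsub>V\<^esub> y}" (is "?A = ?B")
  proof
    show "?A \<subseteq> ?B"
      unfolding set_add_def' by (auto intro: tr[OF J_add])
    show "?B \<subseteq> ?A"
      unfolding set_add_def' using xy by blast
  qed
  then show ?thesis
    by (simp add: quotient_semimodule_def)
qed

lemma quotient_smult:
  assumes "a \<in> carrier S" "x \<in> carrier V"
  shows "a \<odot>\<^bsub>quotient_semimodule V J\<^esub> J `` {x} = J `` {a \<odot>\<^bsub>V\<^esub> x}"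
proof -
  have x: "(x, x) \<in> J"
    using assms J_equiv by (auto simp: equiv_def refl_on_def)
  have tr: "(u, w) \<in> J" if "(u, v) \<in> J" "(v, w) \<in> J" for u v w
    using J_equiv that by (meson equivE transD)
  have "J `` ((\<lambda>x. a \<odot>\<^bsub>V\<^esub> x) ` (J `` {x})) = J `` {a \<odot>\<^bsub>V\<^esub> x}" (is "?A = ?B")
  proof
    show "?A \<subseteq> ?B"
      by (auto intro: tr[OF J_smult[OF assms(1)]])
    show "?B \<subseteq> ?A"
      using x by blast
  qed
  then show ?thesis
    by (simp add: quotient_semimodule_def)
qed

lemma quotient_semimodule:
  assumes "semimodule S V"
  shows "semimodule S (quotient_semimodule V J)"
proof -
  interpret V: semimodule S V by fact
  let ?Q = "quotient_semimodule V J"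
  have rep: "\<exists>x\<in>carrier V. A = J `` {x}" if "A \<in> carrier ?Q" for A
    using that by (auto simp: quotient_semimodule_def quotient_def)
  have cl: "J `` {x} \<in> carrier ?Q" if "x \<in> carrier V" for x
    using that by (auto simp: quotient_semimodule_def quotient_def)
  have z: "\<zero>\<^bsub>?Q\<^esub> = J `` {\<zero>\<^bsub>V\<^esub>}" by (simp add: quotient_semimodule_def)
  note simps = z quotient_add quotient_smult cl V.smult_closed V.zero_closed V.a_closed
  have ab: "abelian_monoid ?Q"
  proof (rule abelian_monoidI)
    fix A B C
    assume "A \<in> carrier ?Q" "B \<in> carrier ?Q" "C \<in> carrier ?Q"
    then obtain x y z where "x \<in> carrier V" "A = J `` {x}" "y \<in> carrier V" "B = J `` {y}"
      "z \<in> carrier V" "C = J `` {z}" by (meson rep)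
    then show "A \<oplus>\<^bsub>?Q\<^esub> B \<oplus>\<^bsub>?Q\<^esub> C = A \<oplus>\<^bsub>?Q\<^esub> (B \<oplus>\<^bsub>?Q\<^esub> C)"
      by (simp add: simps V.a_assoc)
  next
    fix A B
    assume "A \<in> carrier ?Q" "B \<in> carrier ?Q"
    then obtain x y where "x \<in> carrier V" "A = J `` {x}" "y \<in> carrier V" "B = J `` {y}"
      by (meson rep)
    then show "A \<oplus>\<^bsub>?Q\<^esub> B = B \<oplus>\<^bsub>?Q\<^esub> A" and "A \<oplus>\<^bsub>?Q\<^esub> B \<in> carrier ?Q"
      by (simp_all add: simps V.a_comm)
  next
    fix A
    assume "A \<in> carrier ?Q"
    then obtain x where "x \<in> carrier V" "A = J `` {x}"
      by (meson rep)
    then show "\<zero>\<^bsub>?Q\<^esub> \<oplus>\<^bsub>?Q\<^esub> A = A"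
      by (simp add: simps)
  qed (simp add: simps)
  have sc: "a \<odot>\<^bsub>?Q\<^esub> A \<in> carrier ?Q" if "a \<in> carrier S" "A \<in> carrier ?Q" for a A
    using rep[OF that(2)] that(1) by (auto simp: simps)
  have ld: "(a \<oplus>\<^bsub>S\<^esub> b) \<odot>\<^bsub>?Q\<^esub> A = a \<odot>\<^bsub>?Q\<^esub> A \<oplus>\<^bsub>?Q\<^esub> b \<odot>\<^bsub>?Q\<^esub> A"
    if "a \<in> carrier S" "b \<in> carrier S" "A \<in> carrier ?Q" for a b A
    using rep[OF that(3)] that(1,2) by (auto simp: simps V.smult_l_distr)
  have rd: "a \<odot>\<^bsub>?Q\<^esub> (A \<oplus>\<^bsub>?Q\<^esub> B) = a \<odot>\<^bsub>?Q\<^esub> A \<oplus>\<^bsub>?Q\<^esub> a \<odot>\<^bsub>?Q\<^esub> B"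
    if "a \<in> carrier S" "A \<in> carrier ?Q" "B \<in> carrier ?Q" for a A B
    using rep[OF that(2)] rep[OF that(3)] that(1) by (auto simp: simps V.smult_r_distr)
  have as: "(a \<otimes>\<^bsub>S\<^esub> b) \<odot>\<^bsub>?Q\<^esub> A = a \<odot>\<^bsub>?Q\<^esub> (b \<odot>\<^bsub>?Q\<^esub> A)"
    if "a \<in> carrier S" "b \<in> carrier S" "A \<in> carrier ?Q" for a b A
    using rep[OF that(3)] that(1,2) by (auto simp: simps V.smult_assoc1)
  have on: "\<one>\<^bsub>S\<^esub> \<odot>\<^bsub>?Q\<^esub> A = A" if "A \<in> carrier ?Q" for A
    using rep[OF that] by (auto simp: simps V.smult_one)
  have ln: "\<zero>\<^bsub>S\<^esub> \<odot>\<^bsub>?Q\<^esub> A = \<zero>\<^bsub>?Q\<^esub>" if "A \<in> carrier ?Q" for A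
    using rep[OF that] by (auto simp: simps V.smult_l_null)
  have rn: "a \<odot>\<^bsub>?Q\<^esub> \<zero>\<^bsub>?Q\<^esub> = \<zero>\<^bsub>?Q\<^esub>" if "a \<in> carrier S" for a
    using that by (simp add: simps V.smult_r_null)
  show ?thesis
    by (rule semimodule.intro[OF V.csemiring_axioms ab], rule semimodule_axioms.intro)
       (fact sc ld rd as on ln rn)+
qed

end

context csemiring
begin

context
  fixes M :: "'m set" and p :: 'm and f :: "'m \<Rightarrow> 'a"
  assumes f: "f \<in> carrier (free_semimodule S M p)"
begin

lemma bend_congruence:
  "semimodule_congruence S (free_semimodule S M p) (bend_congruence S M p f)"
  "bend_relations S M p f \<subseteq> bend_congruence S M p f"
proof -
  interpret F: semimodule S "free_semimodule S M p" by (rule free_semimodule)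
  have "delete_term S f m \<in> carrier (free_semimodule S M p)" if "m \<in> supp S M p f" for m
  proof -
    have "finite (supp S M p (delete_term S f m))"
      by (rule finite_subset[of _ "supp S M p f"])
         (use f in \<open>auto simp: supp_def delete_term_def free_semimodule_def\<close>)
    then show ?thesis
      using f that
      by (auto simp: supp_def delete_term_def free_semimodule_def PiE_iff extensional_def)
  qed
  then have "bend_relations S M p f
      \<subseteq> carrier (free_semimodule S M p) \<times> carrier (free_semimodule S M p)"
    using f by (auto simp: bend_relations_def)
  from F.semimodule_congruence_generated[OF this]
  show "semimodule_congruence S (free_semimodule S M p) (bend_congruence S M p f)"
    "bend_relations S M p f \<subseteq> bend_congruence S M p f"
    by (simp_all add: bend_congruence_def)
qed

lemma bend_quotient_semimodule: "semimodule S (bend_quotient S M p f)"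
  unfolding bend_quotient_def
  by (rule quotient_semimodule[OF bend_congruence(1) free_semimodule])

lemma bend_subsemimodule:
  "subsemimodule S (dual S (free_semimodule S M p)) (carrier (bend S M p f))"
  and bend_pullback_iso:
  "bend_pullback S M p f
     \<in> semimodule_iso S (dual S (bend_quotient S M p f)) (bend S M p f)"
proof -
  let ?F = "free_semimodule S M p" and ?J = "bend_congruence S M p f"
  let ?Q = "bend_quotient S M p f" and ?h = "bend_pullback S M p f"
  interpret F: semimodule S ?F by (rule free_semimodule)
  interpret Q: semimodule S ?Q by (rule bend_quotient_semimodule)
  interpret D: semimodule S "dual S ?Q" by (rule dual_semimodule) (rule bend_quotient_semimodule)
  have cl: "?J `` {v} \<in> carrier ?Q" if "v \<in> carrier ?F" for v
    using that by (auto simp: bend_quotient_def quotient_semimodule_def quotient_def)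
  have rep: "\<exists>v\<in>carrier ?F. A = ?J `` {v}" if "A \<in> carrier ?Q" for A
    using that by (auto simp: bend_quotient_def quotient_semimodule_def quotient_def)
  have z: "?J `` {\<zero>\<^bsub>?F\<^esub>} = \<zero>\<^bsub>?Q\<^esub>"
    by (simp add: bend_quotient_def quotient_semimodule_def)
  note add = quotient_add[OF bend_congruence(1), folded bend_quotient_def, symmetric]
  note smult = quotient_smult[OF bend_congruence(1), folded bend_quotient_def, symmetric]
  have h_closed: "?h \<phi> \<in> carrier (dual S ?F)" if "\<phi> \<in> carrier (dual S ?Q)" for \<phi>
    using that
    by (auto simp: dual_def semimodule_hom_def self_semimodule_def bend_pullback_def Pi_iff
          z add smult cl F.smult_closed)
  have h_zero: "?h \<zero>\<^bsub>dual S ?Q\<^esub> = \<zero>\<^bsub>dual S ?F\<^esub>"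
    by (auto simp: dual_def bend_pullback_def cl)
  have h_add: "?h (\<phi> \<oplus>\<^bsub>dual S ?Q\<^esub> \<psi>) = ?h \<phi> \<oplus>\<^bsub>dual S ?F\<^esub> ?h \<psi>" for \<phi> \<psi>
    by (auto simp: dual_def bend_pullback_def cl)
  have h_smult: "?h (a \<odot>\<^bsub>dual S ?Q\<^esub> \<phi>) = a \<odot>\<^bsub>dual S ?F\<^esub> ?h \<phi>" for a \<phi>
    by (auto simp: dual_def bend_pullback_def cl)
  have carrier: "carrier (bend S M p f) = ?h ` carrier (dual S ?Q)"
    by (simp add: bend_def)
  show "subsemimodule S (dual S ?F) (carrier (bend S M p f))"
    unfolding subsemimodule_def carrier
    by (auto simp: h_closed h_zero[symmetric] h_add[symmetric] h_smult[symmetric] D.smult_closed)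
  have "inj_on ?h (carrier (dual S ?Q))"
  proof (rule inj_onI)
    fix \<phi> \<psi>
    assume "\<phi> \<in> carrier (dual S ?Q)" "\<psi> \<in> carrier (dual S ?Q)" and eq: "?h \<phi> = ?h \<psi>"
    then have "\<phi> \<in> extensional (carrier ?Q)" "\<psi> \<in> extensional (carrier ?Q)"
      by (auto simp: dual_def)
    moreover have "\<phi> A = \<psi> A" if A: "A \<in> carrier ?Q" for A
    proof -
      obtain v where "v \<in> carrier ?F" "A = ?J `` {v}" using rep[OF A] by blast
      then show ?thesis using fun_cong[OF eq, of v] by (simp add: bend_pullback_def)
    qed
    ultimately show "\<phi> = \<psi>" by (rule extensionalityI)
  qed
  moreover have "?h \<in> semimodule_hom S (dual S ?Q) (bend S M p f)"
    using h_zero h_add h_smult by (auto simp: semimodule_hom_def bend_def)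
  ultimately show "?h \<in> semimodule_iso S (dual S ?Q) (bend S M p f)"
    by (simp add: semimodule_iso_def bij_betw_def carrier)
qed

lemma bend_evaluation_pullback:
  assumes "\<phi> \<in> carrier (dual S (bend_quotient S M p f))"
    and "A \<in> carrier (bend_quotient S M p f)"
  shows "bend_evaluation S M p f A (bend_pullback S M p f \<phi>) = \<phi> A"
proof -
  let ?F = "free_semimodule S M p" and ?J = "bend_congruence S M p f"
  have eqv: "equiv (carrier ?F) ?J"
    using bend_congruence(1) by (simp add: semimodule_congruence_def)
  obtain v where v: "v \<in> carrier ?F" "A = ?J `` {v}"
    using assms(2) by (auto simp: bend_quotient_def quotient_semimodule_def quotient_def)
  have "bend_pullback S M p f \<phi> w = \<phi> A" if "w \<in> A" for w
  proof -
    have "(v, w) \<in> ?J" using that v by simp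
    then have "w \<in> carrier ?F" "?J `` {v} = ?J `` {w}"
      using eqv equiv_class_eq[OF eqv] by (auto simp: equiv_def)
    then show ?thesis using v by (simp add: bend_pullback_def)
  qed
  moreover have "v \<in> A"
    using v equiv_class_self[OF eqv] by simp
  ultimately have "bend_pullback S M p f \<phi> ` A = {\<phi> A}"
    by force
  then show ?thesis
    using assms(1) by (simp add: bend_evaluation_def bend_def)
qed

end

end

end

theory Submission
  imports Defs
begin

text \<open>Write \<open>E\<close> for the support of \<open>f\<close>, and \<open>x\<^sub>i = v\<^sub>i / f\<^sub>i\<close> for the rescaled coordinates of a vector \<open>v\<close>
  at \<open>i \<in> E\<close>; this makes sense because the coefficients \<open>f\<^sub>i\<close> are units.  Addition is the maximum of
  the total order.  Two kinds of linear forms obviously lie in the bend locus: the coordinates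
  \<open>v\<^sub>m\<close> with \<open>m \<notin> E\<close>, and the forms \<open>x\<^sub>i + x\<^sub>j\<close> with \<open>i \<noteq> j\<close> in \<open>E\<close> (\<open>pair_form\<close> below).  The proof rests on
  three facts about them.

  They generate the bend locus (\<open>bend_generated\<close>).  A form \<open>\<Sum> a\<^sub>m v\<^sub>m\<close> of the bend locus has coefficients
  whose largest product \<open>a\<^sub>q f\<^sub>q\<close> is also the sum of the other products \<open>a\<^sub>m f\<^sub>m\<close>; so
  adding \<open>(a\<^sub>m f\<^sub>m) (x\<^sub>m + x\<^sub>q)\<close> over \<open>m \<noteq> q\<close> in \<open>E\<close> gives the correct coefficient at \<open>q\<close> as well.

  They separate the classes of the bend congruence (\<open>bend_forms_separate\<close>).  If all of them agree on
  \<open>v\<close> and \<open>w\<close>, then \<open>v + w\<close> exceeds \<open>v\<close> in at most one coordinate \<open>i \<in> E\<close>, and there the rescaled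
  coordinate of \<open>v + w\<close> is a constant \<open>c\<close> that is at most every other \<open>x\<^sub>j\<close>.  Hence
  \<open>v + w = v + c f\<close>, while \<open>v\<close> itself is \<open>v + c f'\<close> for \<open>f'\<close> the deletion of the \<open>i\<close>-term from \<open>f\<close>, and one
  bend relation identifies the two.  Exchanging \<open>v\<close> and \<open>w\<close> gives \<open>v \<sim> v + w \<sim> w\<close>.

  Every linear form \<open>\<Phi>\<close> on the bend locus is the evaluation at a vector
  (\<open>bend_dual_form_is_evaluation\<close>).  Put \<open>t\<^sub>i\<^sub>j = \<Phi> (x\<^sub>i + x\<^sub>j)\<close> and take for the rescaled \<open>i\<close>-th coordinate
  the number \<open>u\<^sub>i = min\<^sub>j t\<^sub>i\<^sub>j\<close>.  Then \<open>u\<^sub>i + u\<^sub>j \<le> t\<^sub>i\<^sub>j\<close> by construction, and conversely, if the minima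
  are \<open>u\<^sub>i = t\<^sub>i\<^sub>k\<close> and \<open>u\<^sub>j = t\<^sub>j\<^sub>l\<close>, then \<open>x\<^sub>i + x\<^sub>j \<le> (x\<^sub>i + x\<^sub>k) + (x\<^sub>j + x\<^sub>l)\<close> gives \<open>t\<^sub>i\<^sub>j \<le> u\<^sub>i + u\<^sub>j\<close>.  So
  evaluation at this vector agrees with \<open>\<Phi>\<close> on the generators.

  The last two facts say that evaluation of the bend locus at classes is bijective.  The double
  dual map is this evaluation followed by the transpose of the isomorphism from the dual of the
  quotient onto the bend locus.\<close>

section \<open>Linear forms on semimodules\<close>

context csemiring
begin

lemma mem_dual_iff:
  "\<phi> \<in> carrier (dual S V) \<longleftrightarrow> \<phi> \<in> extensional (carrier V) \<and>
     (\<forall>x\<in>carrier V. \<phi> x \<in> carrier S) \<and> \<phi> \<zero>\<^bsub>V\<^esub> = \<zero> \<and>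
     (\<forall>x\<in>carrier V. \<forall>y\<in>carrier V. \<phi> (x \<oplus>\<^bsub>V\<^esub> y) = \<phi> x \<oplus> \<phi> y) \<and>
     (\<forall>a\<in>carrier S. \<forall>x\<in>carrier V. \<phi> (a \<odot>\<^bsub>V\<^esub> x) = a \<otimes> \<phi> x)"
  by (auto simp: dual_def semimodule_hom_def self_semimodule_def)

lemma dual_simps:
  "\<zero>\<^bsub>dual S V\<^esub> = (\<lambda>x\<in>carrier V. \<zero>)"
  "\<phi> \<oplus>\<^bsub>dual S V\<^esub> \<psi> = (\<lambda>x\<in>carrier V. \<phi> x \<oplus> \<psi> x)"
  "a \<odot>\<^bsub>dual S V\<^esub> \<phi> = (\<lambda>x\<in>carrier V. a \<otimes> \<phi> x)"
  by (simp_all add: dual_def)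

lemma form_finsum:
  assumes "semimodule S V" and "\<phi> \<in> carrier (dual S V)"
    and "finite A" and "g \<in> A \<rightarrow> carrier V"
  shows "\<phi> (finsum V g A) = (\<Oplus>i\<in>A. \<phi> (g i))"
proof -
  interpret V: semimodule S V by fact
  from assms(3,4) show ?thesis
    using assms(2) by (induction A) (auto simp: mem_dual_iff Pi_iff)
qed

lemma finsum_dual:
  assumes "semimodule S V" and "x \<in> carrier V"
    and "finite A" and "g \<in> A \<rightarrow> carrier (dual S V)"
  shows "finsum (dual S V) g A x = (\<Oplus>i\<in>A. g i x)"
proof -
  interpret D: semimodule S "dual S V" by (rule dual_semimodule) fact
  have "g i x \<in> carrier S" if "g i \<in> carrier (dual S V)" for i
    using that assms(2) by (simp add: mem_dual_iff)
  with assms(3,4) show ?thesis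
    by (induction A) (auto simp: assms(2) dual_simps Pi_iff)
qed

lemma subsemimodule_finsum:
  assumes "semimodule S V" and "subsemimodule S V H" and "finite A" and "g \<in> A \<rightarrow> H"
  shows "finsum V g A \<in> H"
proof -
  interpret V: semimodule S V by fact
  have H: "H \<subseteq> carrier V" "\<zero>\<^bsub>V\<^esub> \<in> H" "\<And>x y. x \<in> H \<Longrightarrow> y \<in> H \<Longrightarrow> x \<oplus>\<^bsub>V\<^esub> y \<in> H"
    using assms(2) by (auto simp: subsemimodule_def)
  from assms(3,4) show ?thesis
  proof (induction A)
    case (insert i A)
    then have "g \<in> A \<rightarrow> carrier V" "g i \<in> carrier V" using H(1) by auto
    with insert show ?case by (simp add: H(3))
  qed (simp add: H)
qed

text \<open>A linear form that respects generators of a congruence thus factors through the quotient: the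
  generated congruence is contained in its kernel.\<close>

lemma form_kernel_congruence:
  assumes "semimodule S V" and "\<psi> \<in> carrier (dual S V)"
  shows "semimodule_congruence S V {(x, y) \<in> carrier V \<times> carrier V. \<psi> x = \<psi> y}"
proof -
  interpret V: semimodule S V by fact
  show ?thesis
    using assms(2)
    by (auto simp: semimodule_congruence_def subsemimodule_def prod_semimodule_def mem_dual_iff
        equiv_def refl_on_def sym_def trans_def V.smult_closed)
qed

lemma transpose_iso:
  assumes "semimodule S V" and "h \<in> semimodule_iso S V W"
  shows "(\<lambda>\<Phi>. \<lambda>x\<in>carrier V. \<Phi> (h x)) \<in> semimodule_iso S (dual S W) (dual S V)" (is "?T \<in> _")
proof -
  interpret V: semimodule S V by fact
  have bij: "bij_betw h (carrier V) (carrier W)"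
    and h0: "h \<zero>\<^bsub>V\<^esub> = \<zero>\<^bsub>W\<^esub>"
    using assms(2) by (auto simp: semimodule_iso_def semimodule_hom_def)
  have ha: "h (x \<oplus>\<^bsub>V\<^esub> y) = h x \<oplus>\<^bsub>W\<^esub> h y" if "x \<in> carrier V" "y \<in> carrier V" for x y
    using assms(2) that by (auto simp: semimodule_iso_def semimodule_hom_def)
  have hs: "h (a \<odot>\<^bsub>V\<^esub> x) = a \<odot>\<^bsub>W\<^esub> h x" if "a \<in> carrier S" "x \<in> carrier V" for a x
    using assms(2) that by (auto simp: semimodule_iso_def semimodule_hom_def)
  have hc: "h x \<in> carrier W" if "x \<in> carrier V" for x
    using bij that by (auto simp: bij_betw_def)
  have hr: "\<exists>x\<in>carrier V. y = h x" if "y \<in> carrier W" for y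
    using bij_betw_imp_surj_on[OF bij] that by blast
  define k where "k = inv_into (carrier V) h"
  have kh: "k (h x) = x" if "x \<in> carrier V" for x
    using bij that by (simp add: k_def bij_betw_def)
  have closed: "?T \<Phi> \<in> carrier (dual S V)" if "\<Phi> \<in> carrier (dual S W)" for \<Phi>
    using that by (auto simp: mem_dual_iff h0 ha hs hc V.smult_closed)
  have "inj_on ?T (carrier (dual S W))"
  proof (rule inj_onI)
    fix \<Phi> \<Psi>
    assume \<Phi>: "\<Phi> \<in> carrier (dual S W)" "\<Psi> \<in> carrier (dual S W)" and eq: "?T \<Phi> = ?T \<Psi>"
    have "\<Phi> y = \<Psi> y" if "y \<in> carrier W" for y
    proof -
      obtain x where "x \<in> carrier V" "y = h x" using hr[OF \<open>y \<in> carrier W\<close>] by blast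
      then show ?thesis using fun_cong[OF eq, of x] by simp
    qed
    then show "\<Phi> = \<Psi>"
      using \<Phi> by (intro extensionalityI[of _ "carrier W"]) (auto simp: mem_dual_iff)
  qed
  moreover have "\<Psi> \<in> ?T ` carrier (dual S W)" if \<Psi>: "\<Psi> \<in> carrier (dual S V)" for \<Psi>
  proof
    \<comment> \<open>The inverse is the transpose of the inverse of \<open>h\<close>.\<close>
    let ?\<Phi> = "\<lambda>y\<in>carrier W. \<Psi> (k y)"
    have val: "?\<Phi> (h x) = \<Psi> x" if "x \<in> carrier V" for x
      using that by (simp add: hc kh)
    show "\<Psi> = ?T ?\<Phi>"
      using \<Psi> val by (intro extensionalityI[of _ "carrier V"]) (auto simp: mem_dual_iff)
    have "\<forall>y\<in>carrier W. ?\<Phi> y \<in> carrier S"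
    proof
      fix y assume "y \<in> carrier W"
      then obtain x where x: "x \<in> carrier V" "y = h x" using hr by blast
      show "?\<Phi> y \<in> carrier S"
        using \<Psi> x(1) unfolding x(2) val[OF x(1)] by (simp add: mem_dual_iff)
    qed
    moreover have "?\<Phi> \<zero>\<^bsub>W\<^esub> = \<zero>"
      using \<Psi> val[of "\<zero>\<^bsub>V\<^esub>"] h0 by (simp add: mem_dual_iff)
    moreover have "?\<Phi> (y \<oplus>\<^bsub>W\<^esub> z) = ?\<Phi> y \<oplus> ?\<Phi> z" if yz: "y \<in> carrier W" "z \<in> carrier W" for y z
    proof -
      obtain u v where uv: "u \<in> carrier V" "y = h u" "v \<in> carrier V" "z = h v"
        using hr yz by meson
      then show ?thesis
        using \<Psi> val[of u] val[of v] val[of "u \<oplus>\<^bsub>V\<^esub> v"] by (simp add: mem_dual_iff ha)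
    qed
    moreover have "?\<Phi> (a \<odot>\<^bsub>W\<^esub> y) = a \<otimes> ?\<Phi> y" if ay: "a \<in> carrier S" "y \<in> carrier W" for a y
    proof -
      obtain u where u: "u \<in> carrier V" "y = h u"
        using hr ay by meson
      then show ?thesis
        using \<Psi> ay val[of u] val[of "a \<odot>\<^bsub>V\<^esub> u"] by (simp add: mem_dual_iff hs V.smult_closed)
    qed
    ultimately show "?\<Phi> \<in> carrier (dual S W)"
      unfolding mem_dual_iff by auto
  qed
  moreover have "?T \<in> semimodule_hom S (dual S W) (dual S V)"
    using closed by (auto simp: semimodule_hom_def dual_simps hc)
  ultimately show ?thesis
    using closed by (auto simp: semimodule_iso_def bij_betw_def)
qed

end

lemma semimodule_iso_comp:
  assumes "g \<in> semimodule_iso S U V" and "h \<in> semimodule_iso S V W"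
  shows "h \<circ> g \<in> semimodule_iso S U W"
  using assms bij_betw_trans[of g "carrier U" "carrier V" h "carrier W"]
  by (auto simp: semimodule_iso_def semimodule_hom_def Pi_iff)

lemma semimodule_iso_cong:
  assumes "semimodule S V" and "g \<in> semimodule_iso S V W" and "\<And>x. x \<in> carrier V \<Longrightarrow> h x = g x"
  shows "h \<in> semimodule_iso S V W"
proof -
  interpret V: semimodule S V by fact
  show ?thesis
    using assms(2,3) bij_betw_cong[of "carrier V" h g "carrier W"]
    by (auto simp: semimodule_iso_def semimodule_hom_def Pi_iff V.smult_closed)
qed

section \<open>Linear forms on free semimodules\<close>

definition coord :: "('a, 'x) ring_scheme \<Rightarrow> 'm set \<Rightarrow> 'm \<Rightarrow> 'm \<Rightarrow> ('m \<Rightarrow> 'a) \<Rightarrow> 'a" where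
  "coord S M p m = (\<lambda>v\<in>carrier (free_semimodule S M p). v m)"

context csemiring
begin

lemma free_coeff:
  assumes "m \<in> M - {p}"
  shows "\<zero>\<^bsub>free_semimodule S M p\<^esub> m = \<zero>"
    and "(u \<oplus>\<^bsub>free_semimodule S M p\<^esub> v) m = u m \<oplus> v m"
    and "(a \<odot>\<^bsub>free_semimodule S M p\<^esub> v) m = a \<otimes> v m"
  using assms by (simp_all add: free_semimodule_def)

lemma free_carrier:
  assumes "finite M"
  shows "carrier (free_semimodule S M p) = (M - {p} \<rightarrow>\<^sub>E carrier S)"
  using assms by (auto simp: free_semimodule_def supp_def)

lemma free_coeff_closed:
  "v \<in> carrier (free_semimodule S M p) \<Longrightarrow> m \<in> M - {p} \<Longrightarrow> v m \<in> carrier S"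
  using PiE_mem[of v "M - {p}" "\<lambda>_. carrier S"] by (simp add: free_semimodule_def)

lemma free_eqI:
  assumes "u \<in> carrier (free_semimodule S M p)" "v \<in> carrier (free_semimodule S M p)"
    and "\<And>m. m \<in> M - {p} \<Longrightarrow> u m = v m"
  shows "u = v"
  using assms by (intro extensionalityI[of u "M - {p}" v]) (auto simp: free_semimodule_def PiE_def)

lemma coord_closed:
  assumes "m \<in> M - {p}"
  shows "coord S M p m \<in> carrier (dual S (free_semimodule S M p))"
proof -
  interpret F: semimodule S "free_semimodule S M p" by (rule free_semimodule)
  show ?thesis
    using free_coeff_closed[OF _ assms]
    by (auto simp: mem_dual_iff coord_def free_coeff[OF assms] F.smult_closed)
qed

text \<open>The coefficients are the values of the form at the standard basis; the vector is the sum of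
  its terms because all coordinates agree.\<close>

lemma form_expansion:
  assumes "finite M" and "\<psi> \<in> carrier (dual S (free_semimodule S M p))"
    and "v \<in> carrier (free_semimodule S M p)"
  shows "\<psi> v = (\<Oplus>m\<in>M - {p}. \<psi> (\<lambda>k\<in>M - {p}. if k = m then \<one> else \<zero>) \<otimes> v m)"
proof -
  let ?F = "free_semimodule S M p"
  let ?e = "\<lambda>m. \<lambda>k\<in>M - {p}. if k = m then \<one> else \<zero>"
  interpret F: semimodule S ?F by (rule free_semimodule)
  have N: "finite (M - {p})" using assms(1) by simp
  have e: "?e m \<in> carrier ?F" for m by (auto simp: free_carrier[OF assms(1)])
  have vm: "v m \<in> carrier S" if "m \<in> M - {p}" for m
    using free_coeff_closed[OF assms(3) that] .
  have g: "(\<lambda>m. v m \<odot>\<^bsub>?F\<^esub> ?e m) \<in> M - {p} \<rightarrow> carrier ?F"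
    using e vm F.smult_closed by blast
  have "v = finsum ?F (\<lambda>m. v m \<odot>\<^bsub>?F\<^esub> ?e m) (M - {p})" (is "_ = ?sum")
  proof (rule free_eqI[OF assms(3)])
    show sum: "?sum \<in> carrier ?F" by (rule F.V.finsum_closed[OF g])
    fix k assume k: "k \<in> M - {p}"
    have "?sum k = coord S M p k ?sum" using sum by (simp add: coord_def)
    also have "\<dots> = (\<Oplus>m\<in>M - {p}. coord S M p k (v m \<odot>\<^bsub>?F\<^esub> ?e m))"
      by (rule form_finsum[OF free_semimodule coord_closed[OF k] N g])
    also have "\<dots> = (\<Oplus>m\<in>M - {p}. if k = m then v m else \<zero>)"
      using k vm F.smult_closed[OF vm e]
      by (intro finsum_cong') (auto simp: coord_def free_coeff[OF k])
    also have "\<dots> = v k"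
      using k N vm by (intro finsum_singleton) auto
    finally show "v k = ?sum k" by simp
  qed
  then have "\<psi> v = (\<Oplus>m\<in>M - {p}. \<psi> (v m \<odot>\<^bsub>?F\<^esub> ?e m))"
    using form_finsum[OF free_semimodule assms(2) N g] by simp
  also have "\<dots> = (\<Oplus>m\<in>M - {p}. \<psi> (?e m) \<otimes> v m)"
  proof (rule finsum_cong')
    show "(\<lambda>m. \<psi> (?e m) \<otimes> v m) \<in> M - {p} \<rightarrow> carrier S"
      using assms(2) e vm by (auto simp: mem_dual_iff)
    fix m assume m: "m \<in> M - {p}"
    show "\<psi> (v m \<odot>\<^bsub>?F\<^esub> ?e m) = \<psi> (?e m) \<otimes> v m"
      using assms(2) e[of m] vm[OF m] by (simp add: mem_dual_iff m_comm)
  qed simp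
  finally show ?thesis .
qed

end

section \<open>The natural order of a totally ordered idempotent semifield\<close>

context totally_ordered_idempotent_semifield
begin

abbreviation nle (infix "\<preceq>" 50) where "a \<preceq> b \<equiv> a \<oplus> b = b"

lemma nle_linear: "a \<in> carrier S \<Longrightarrow> b \<in> carrier S \<Longrightarrow> a \<preceq> b \<or> b \<preceq> a"
  using linear_natural_order add_idem
  by (cases "a = b") (auto simp: linear_order_on_def total_on_def natural_order_def)

lemma add_left_idem: "a \<in> carrier S \<Longrightarrow> b \<in> carrier S \<Longrightarrow> a \<oplus> (a \<oplus> b) = a \<oplus> b"
  by (simp add: a_assoc[symmetric] add_idem)

lemma nle_trans:
  assumes "a \<preceq> b" "b \<preceq> c" and "a \<in> carrier S" "b \<in> carrier S" "c \<in> carrier S"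
  shows "a \<preceq> c"
  using assms by (metis a_assoc)

lemma finite_has_nle_minimum:
  assumes "finite T" "T \<noteq> {}" "T \<subseteq> carrier S"
  shows "\<exists>m\<in>T. \<forall>t\<in>T. m \<preceq> t"
  using assms
proof (induction T rule: finite_ne_induct)
  case (singleton x)
  then show ?case by (simp add: add_idem)
next
  case (insert x T)
  then obtain m where m: "m \<in> T" "\<forall>t\<in>T. m \<preceq> t" by auto
  have c: "x \<in> carrier S" "m \<in> carrier S" "T \<subseteq> carrier S" using insert m by auto
  show ?case
  proof (cases "x \<preceq> m")
    case True
    then have "\<forall>t\<in>T. x \<preceq> t" using m c nle_trans by blast
    then show ?thesis using c add_idem by auto
  next
    case False
    then have "m \<preceq> x" using nle_linear c by blast
    then show ?thesis using m by auto
  qed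
qed

lemma finite_has_nle_maximum:
  assumes "finite T" "T \<noteq> {}" "T \<subseteq> carrier S"
  shows "\<exists>m\<in>T. \<forall>t\<in>T. t \<preceq> m"
  using assms
proof (induction T rule: finite_ne_induct)
  case (singleton x)
  then show ?case by (simp add: add_idem)
next
  case (insert x T)
  then obtain m where m: "m \<in> T" "\<forall>t\<in>T. t \<preceq> m" by auto
  have c: "x \<in> carrier S" "m \<in> carrier S" "T \<subseteq> carrier S" using insert m by auto
  show ?case
  proof (cases "m \<preceq> x")
    case True
    then have "\<forall>t\<in>T. t \<preceq> x" using m c nle_trans by blast
    then show ?thesis using c add_idem by auto
  next
    case False
    then have "x \<preceq> m" using nle_linear c by blast
    then show ?thesis using m by auto
  qed
qed

lemma finsum_nle:
  assumes "finite A" "g \<in> A \<rightarrow> carrier S" "c \<in> carrier S" "\<And>i. i \<in> A \<Longrightarrow> g i \<preceq> c"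
  shows "(\<Oplus>i\<in>A. g i) \<preceq> c"
  using assms
proof (induction A)
  case (insert i A)
  then have "g \<in> A \<rightarrow> carrier S" "g i \<in> carrier S" by auto
  with insert show ?case by (simp add: a_assoc)
qed simp

end

section \<open>The bend locus\<close>

text \<open>For \<open>i \<noteq> j\<close> in the support of \<open>f\<close>, both summands have the value \<open>1\<close> on \<open>f\<close>, and the deletion of a
  term of \<open>f\<close> leaves at least one of them intact; so the form belongs to the bend locus.\<close>

definition pair_form ::
    "('a, 'x) ring_scheme \<Rightarrow> 'm set \<Rightarrow> 'm \<Rightarrow> ('m \<Rightarrow> 'a) \<Rightarrow> 'm \<Rightarrow> 'm \<Rightarrow> ('m \<Rightarrow> 'a) \<Rightarrow> 'a" where
  "pair_form S M p f i j =
     (\<lambda>v\<in>carrier (free_semimodule S M p). inv\<^bsub>S\<^esub> f i \<otimes>\<^bsub>S\<^esub> v i \<oplus>\<^bsub>S\<^esub> inv\<^bsub>S\<^esub> f j \<otimes>\<^bsub>S\<^esub> v j)"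

context csemiring
begin

context
  fixes M :: "'m set" and p :: 'm and f :: "'m \<Rightarrow> 'a"
  assumes f: "f \<in> carrier (free_semimodule S M p)"
begin

private abbreviation "F \<equiv> free_semimodule S M p"
private abbreviation "J \<equiv> bend_congruence S M p f"
private abbreviation "Q \<equiv> bend_quotient S M p f"

lemma delete_term_closed:
  assumes "m \<in> M - {p}"
  shows "delete_term S f m \<in> carrier F"
proof -
  have "finite (supp S M p (delete_term S f m))"
    by (rule finite_subset[of _ "supp S M p f"])
       (use f in \<open>auto simp: supp_def delete_term_def free_semimodule_def\<close>)
  then show ?thesis
    using f assms by (auto simp: delete_term_def free_semimodule_def PiE_iff extensional_def)
qed

lemma form_const_on_bend_congruence:
  assumes "\<psi> \<in> carrier (dual S F)" and "\<forall>m\<in>supp S M p f. \<psi> f = \<psi> (delete_term S f m)"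
    and "(u, v) \<in> J"
  shows "\<psi> u = \<psi> v"
proof -
  have "bend_relations S M p f \<subseteq> {(x, y) \<in> carrier F \<times> carrier F. \<psi> x = \<psi> y}"
    using assms(2) f delete_term_closed by (auto simp: bend_relations_def supp_def)
  then have "J \<subseteq> {(x, y) \<in> carrier F \<times> carrier F. \<psi> x = \<psi> y}"
    unfolding bend_congruence_def generated_congruence_def
    using form_kernel_congruence[OF free_semimodule assms(1)] by blast
  with assms(3) show ?thesis by auto
qed

lemma bend_class_rep:
  assumes "A \<in> carrier Q"
  obtains v where "v \<in> carrier F" "A = J `` {v}"
  using assms by (auto simp: bend_quotient_def quotient_semimodule_def quotient_def)

lemma bend_class_closed: "v \<in> carrier F \<Longrightarrow> J `` {v} \<in> carrier Q"
  by (auto simp: bend_quotient_def quotient_semimodule_def quotient_def)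

lemma bend_class_zero: "\<zero>\<^bsub>Q\<^esub> = J `` {\<zero>\<^bsub>F\<^esub>}"
  by (simp add: bend_quotient_def quotient_semimodule_def)

lemmas bend_class_add = quotient_add[OF bend_congruence(1)[OF f], folded bend_quotient_def]
lemmas bend_class_smult = quotient_smult[OF bend_congruence(1)[OF f], folded bend_quotient_def]

lemma bend_congruence_equiv: "equiv (carrier F) J"
  using bend_congruence(1)[OF f] by (simp add: semimodule_congruence_def)

text \<open>A form that does not see the deletion of a single term of \<open>f\<close> is constant on the classes of the
  congruence, hence descends to the quotient.  The right-hand side is the tropical
  vanishing condition for \<open>\<psi>\<close> as a point of the hypersurface of \<open>f\<close>.\<close>

lemma mem_bend_iff:
  "\<psi> \<in> carrier (bend S M p f) \<longleftrightarrow>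
     \<psi> \<in> carrier (dual S F) \<and> (\<forall>m\<in>supp S M p f. \<psi> f = \<psi> (delete_term S f m))"
proof (intro iffI conjI ballI; (elim conjE)?)
  interpret F: semimodule S F by (rule free_semimodule)
  assume \<psi>: "\<psi> \<in> carrier (bend S M p f)"
  then show "\<psi> \<in> carrier (dual S F)"
    using bend_subsemimodule[OF f] by (auto simp: subsemimodule_def)
  fix m assume m: "m \<in> supp S M p f"
  then have "(f, delete_term S f m) \<in> J"
    using bend_congruence(2)[OF f] by (auto simp: bend_relations_def)
  then have eq: "J `` {f} = J `` {delete_term S f m}"
    by (rule equiv_class_eq[OF bend_congruence_equiv])
  have "delete_term S f m \<in> carrier F"
    using m by (intro delete_term_closed) (simp add: supp_def)
  moreover obtain \<phi> where "\<psi> = bend_pullback S M p f \<phi>"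
    using \<psi> by (auto simp: bend_def)
  ultimately show "\<psi> f = \<psi> (delete_term S f m)"
    using f by (simp add: bend_pullback_def eq)
next
  interpret F: semimodule S F by (rule free_semimodule)
  assume \<psi>: "\<psi> \<in> carrier (dual S F)" and bends: "\<forall>m\<in>supp S M p f. \<psi> f = \<psi> (delete_term S f m)"
  define \<phi> where "\<phi> = (\<lambda>A\<in>carrier Q. the_elem (\<psi> ` A))"
  have val: "\<phi> (J `` {v}) = \<psi> v" if "v \<in> carrier F" for v
  proof -
    have "\<psi> ` (J `` {v}) = {\<psi> v}"
    proof (intro equalityI subsetI)
      fix c assume "c \<in> \<psi> ` (J `` {v})"
      then obtain w where "(v, w) \<in> J" "c = \<psi> w" by blast
      then show "c \<in> {\<psi> v}" using form_const_on_bend_congruence[OF \<psi> bends, of v w] by simp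
    qed (use equiv_class_self[OF bend_congruence_equiv that] in blast)
    then show ?thesis using that by (simp add: \<phi>_def bend_class_closed)
  qed
  have "\<phi> \<in> carrier (dual S Q)"
    unfolding mem_dual_iff
  proof (intro conjI ballI)
    show "\<phi> \<in> extensional (carrier Q)" by (simp add: \<phi>_def)
    show "\<phi> \<zero>\<^bsub>Q\<^esub> = \<zero>" using \<psi> by (simp add: bend_class_zero val mem_dual_iff)
    fix A assume A: "A \<in> carrier Q"
    then obtain u where u: "u \<in> carrier F" "A = J `` {u}" by (rule bend_class_rep)
    then show "\<phi> A \<in> carrier S" using \<psi> by (simp add: val mem_dual_iff)
    show "\<phi> (a \<odot>\<^bsub>Q\<^esub> A) = a \<otimes> \<phi> A" if "a \<in> carrier S" for a
      using \<psi> u that by (simp add: val mem_dual_iff bend_class_smult F.smult_closed)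
    fix B assume "B \<in> carrier Q"
    then obtain v where v: "v \<in> carrier F" "B = J `` {v}" by (rule bend_class_rep)
    then show "\<phi> (A \<oplus>\<^bsub>Q\<^esub> B) = \<phi> A \<oplus> \<phi> B"
      using \<psi> u by (simp add: val mem_dual_iff bend_class_add)
  qed
  moreover have "\<psi> = bend_pullback S M p f \<phi>"
    using \<psi> val
    by (intro extensionalityI[of _ "carrier F"]) (auto simp: mem_dual_iff bend_pullback_def)
  ultimately show "\<psi> \<in> carrier (bend S M p f)"
    by (simp add: bend_def)
qed

lemma bend_form_const:
  "\<psi> \<in> carrier (bend S M p f) \<Longrightarrow> (u, v) \<in> J \<Longrightarrow> \<psi> u = \<psi> v"
  using form_const_on_bend_congruence by (auto simp: mem_bend_iff)

lemma bend_evaluation_class: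
  assumes "v \<in> carrier F"
  shows "bend_evaluation S M p f (J `` {v}) = (\<lambda>\<psi>\<in>carrier (bend S M p f). \<psi> v)"
  unfolding bend_evaluation_def
proof (rule restrict_ext)
  fix \<psi> assume \<psi>: "\<psi> \<in> carrier (bend S M p f)"
  have "v \<in> J `` {v}" by (rule equiv_class_self[OF bend_congruence_equiv assms])
  moreover have "\<psi> w = \<psi> v" if "w \<in> J `` {v}" for w
    using bend_form_const[OF \<psi>, of v w] that by simp
  ultimately have "\<psi> ` (J `` {v}) = {\<psi> v}" by blast
  then show "the_elem (\<psi> ` (J `` {v})) = \<psi> v" by simp
qed

lemma bend_simps:
  "\<zero>\<^bsub>bend S M p f\<^esub> = \<zero>\<^bsub>dual S F\<^esub>"
  "\<phi> \<oplus>\<^bsub>bend S M p f\<^esub> \<psi> = \<phi> \<oplus>\<^bsub>dual S F\<^esub> \<psi>"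
  "a \<odot>\<^bsub>bend S M p f\<^esub> \<psi> = a \<odot>\<^bsub>dual S F\<^esub> \<psi>"
  by (simp_all add: bend_def)

lemma bend_closed:
  "\<zero>\<^bsub>dual S F\<^esub> \<in> carrier (bend S M p f)"
  "\<phi> \<in> carrier (bend S M p f) \<Longrightarrow> \<psi> \<in> carrier (bend S M p f) \<Longrightarrow>
     \<phi> \<oplus>\<^bsub>dual S F\<^esub> \<psi> \<in> carrier (bend S M p f)"
  "a \<in> carrier S \<Longrightarrow> \<psi> \<in> carrier (bend S M p f) \<Longrightarrow>
     a \<odot>\<^bsub>dual S F\<^esub> \<psi> \<in> carrier (bend S M p f)"
  using bend_subsemimodule[OF f] by (auto simp: subsemimodule_def)

lemma bend_form_linear:
  assumes "\<psi> \<in> carrier (bend S M p f)"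
  shows "u \<in> carrier F \<Longrightarrow> \<psi> u \<in> carrier S"
    and "\<psi> \<zero>\<^bsub>F\<^esub> = \<zero>"
    and "u \<in> carrier F \<Longrightarrow> v \<in> carrier F \<Longrightarrow> \<psi> (u \<oplus>\<^bsub>F\<^esub> v) = \<psi> u \<oplus> \<psi> v"
    and "a \<in> carrier S \<Longrightarrow> u \<in> carrier F \<Longrightarrow> \<psi> (a \<odot>\<^bsub>F\<^esub> u) = a \<otimes> \<psi> u"
  using assms by (simp_all add: mem_bend_iff mem_dual_iff)

lemma bend_evaluation_hom:
  "bend_evaluation S M p f \<in> semimodule_hom S Q (dual S (bend S M p f))"
proof -
  interpret F: semimodule S F by (rule free_semimodule)
  let ?h = "bend_evaluation S M p f" and ?B = "bend S M p f"
  have closed: "?h A \<in> carrier (dual S ?B)" if A: "A \<in> carrier Q" for A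
  proof -
    from A obtain u where u: "u \<in> carrier F" "A = J `` {u}" by (rule bend_class_rep)
    show ?thesis
      unfolding u(2) bend_evaluation_class[OF u(1)] mem_dual_iff bend_simps
      using u(1) by (simp add: bend_closed bend_form_linear) (simp add: dual_simps)
  qed
  have zero: "?h \<zero>\<^bsub>Q\<^esub> = \<zero>\<^bsub>dual S ?B\<^esub>"
    unfolding bend_class_zero bend_evaluation_class[OF F.V.zero_closed] dual_simps
    by (intro restrict_ext bend_form_linear)
  have add: "?h (A \<oplus>\<^bsub>Q\<^esub> B) = ?h A \<oplus>\<^bsub>dual S ?B\<^esub> ?h B"
    if A: "A \<in> carrier Q" and B: "B \<in> carrier Q" for A B
  proof -
    from A obtain u where u: "u \<in> carrier F" "A = J `` {u}" by (rule bend_class_rep)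
    from B obtain v where v: "v \<in> carrier F" "B = J `` {v}" by (rule bend_class_rep)
    show ?thesis
      unfolding u(2) v(2) bend_class_add[OF u(1) v(1)] dual_simps
      using u(1) v(1) by (simp add: bend_evaluation_class bend_form_linear cong: restrict_cong)
  qed
  have smult: "?h (a \<odot>\<^bsub>Q\<^esub> A) = a \<odot>\<^bsub>dual S ?B\<^esub> ?h A"
    if a: "a \<in> carrier S" and A: "A \<in> carrier Q" for a A
  proof -
    from A obtain u where u: "u \<in> carrier F" "A = J `` {u}" by (rule bend_class_rep)
    show ?thesis
      unfolding u(2) bend_class_smult[OF a u(1)] dual_simps
      using a u(1)
      by (simp add: bend_evaluation_class bend_form_linear F.smult_closed cong: restrict_cong)
  qed
  show ?thesis
    using closed zero add smult by (simp add: semimodule_hom_def)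
qed

end

end

section \<open>Generators of the bend locus and reflexivity\<close>

context totally_ordered_idempotent_semifield
begin

context
  fixes M :: "'m set" and p :: 'm and f :: "'m \<Rightarrow> 'a"
  assumes finite_M: "finite M"
    and f: "f \<in> carrier (free_semimodule S M p)"
begin

private abbreviation "\<F> \<equiv> free_semimodule S M p"
private abbreviation "\<J> \<equiv> bend_congruence S M p f"
private abbreviation "\<Q> \<equiv> bend_quotient S M p f"
private abbreviation "B \<equiv> bend S M p f"
private abbreviation "E \<equiv> supp S M p f"
private abbreviation "pair \<equiv> pair_form S M p f"

lemma supp_coeff:
  assumes "i \<in> E"
  shows "i \<in> M - {p}" "f i \<in> carrier S" "inv f i \<in> carrier S"
    "f i \<otimes> inv f i = \<one>" "inv f i \<otimes> f i = \<one>"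
proof -
  show i: "i \<in> M - {p}" using assms by (auto simp: supp_def)
  show fi: "f i \<in> carrier S" by (rule free_coeff_closed[OF f i])
  then have "f i \<in> Units S" using assms by (intro nonzero_Units) (auto simp: supp_def)
  then show "inv f i \<in> carrier S" "f i \<otimes> inv f i = \<one>" "inv f i \<otimes> f i = \<one>"
    by simp_all
qed

lemma supp_cancel:
  assumes "i \<in> E" "x \<in> carrier S"
  shows "f i \<otimes> (inv f i \<otimes> x) = x" "inv f i \<otimes> (f i \<otimes> x) = x"
  using supp_coeff[OF assms(1)] assms(2) by (simp_all add: m_assoc[symmetric])

lemma supp_coeff_closed:
  "v \<in> carrier \<F> \<Longrightarrow> i \<in> E \<Longrightarrow> v i \<in> carrier S"
  by (rule free_coeff_closed[OF _ supp_coeff(1)])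

lemma pair_form_eq:
  assumes "i \<in> E" "j \<in> E"
  shows "pair i j = inv f i \<odot>\<^bsub>dual S \<F>\<^esub> coord S M p i \<oplus>\<^bsub>dual S \<F>\<^esub>
    inv f j \<odot>\<^bsub>dual S \<F>\<^esub> coord S M p j"
  by (auto simp: pair_form_def dual_simps coord_def)

lemma pair_form_in_bend:
  assumes i: "i \<in> E" and j: "j \<in> E" and "i \<noteq> j"
  shows "pair i j \<in> carrier B"
  unfolding mem_bend_iff[OF f]
proof (intro conjI ballI)
  interpret D: semimodule S "dual S \<F>" by (rule dual_semimodule) (rule free_semimodule)
  show "pair i j \<in> carrier (dual S \<F>)"
    unfolding pair_form_eq[OF i j]
    by (intro D.V.a_closed D.smult_closed coord_closed supp_coeff(1,3) i j)
  fix m assume "m \<in> E"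
  then have "delete_term S f m \<in> carrier \<F>"
    by (intro delete_term_closed[OF f] supp_coeff(1))
  then show "pair i j f = pair i j (delete_term S f m)"
    using f supp_coeff[OF i] supp_coeff[OF j] \<open>i \<noteq> j\<close>
    by (auto simp: pair_form_def delete_term_def add_idem)
qed

lemma coord_in_bend:
  assumes "m \<in> M - {p}" "m \<notin> E"
  shows "coord S M p m \<in> carrier B"
  unfolding mem_bend_iff[OF f]
proof (intro conjI ballI)
  show "coord S M p m \<in> carrier (dual S \<F>)" by (rule coord_closed[OF assms(1)])
  fix k assume k: "k \<in> E"
  then have "delete_term S f k \<in> carrier \<F>"
    by (intro delete_term_closed[OF f] supp_coeff(1))
  then show "coord S M p m f = coord S M p m (delete_term S f k)"
    using f k assms by (auto simp: coord_def delete_term_def)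
qed

text \<open>A form of the bend locus has coefficients \<open>a\<^sub>m\<close> for which \<open>\<Sum> a\<^sub>m f\<^sub>m\<close> is unchanged when any one term
  is removed.  Removing a largest term, at \<open>q\<close>, gives \<open>\<Sum>\<^bsub>m \<noteq> q\<^esub> a\<^sub>m f\<^sub>m = a\<^sub>q f\<^sub>q\<close>, and this is
  exactly what is needed for the generators attached to the indices \<open>m \<noteq> q\<close> to produce the
  coefficient at \<open>q\<close> too.\<close>

lemma bend_generated:
  assumes H: "subsemimodule S (dual S \<F>) H"
    and coordH: "\<And>m. m \<in> M - {p} \<Longrightarrow> m \<notin> E \<Longrightarrow> coord S M p m \<in> H"
    and pairH: "\<And>i j. i \<in> E \<Longrightarrow> j \<in> E \<Longrightarrow> i \<noteq> j \<Longrightarrow> pair i j \<in> H"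
  shows "carrier B \<subseteq> H"
proof
  fix \<psi> assume "\<psi> \<in> carrier B"
  then have \<psi>: "\<psi> \<in> carrier (dual S \<F>)"
    and bends: "\<And>m. m \<in> E \<Longrightarrow> \<psi> f = \<psi> (delete_term S f m)"
    by (auto simp: mem_bend_iff[OF f])
  let ?N = "M - {p}"
  define a where "a m = \<psi> (\<lambda>k\<in>?N. if k = m then \<one> else \<zero>)" for m
  interpret D: semimodule S "dual S \<F>" by (rule dual_semimodule) (rule free_semimodule)
  have N: "finite ?N" using finite_M by simp
  have a: "a m \<in> carrier S" for m
    using \<psi> by (auto simp: a_def mem_dual_iff free_carrier[OF finite_M])
  have expand: "\<psi> w = (\<Oplus>m\<in>?N. a m \<otimes> w m)" if "w \<in> carrier \<F>" for w
    unfolding a_def by (rule form_expansion[OF finite_M \<psi> that])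
  have Hsub: "H \<subseteq> carrier (dual S \<F>)"
    and Hsmult: "\<And>c \<phi>. c \<in> carrier S \<Longrightarrow> \<phi> \<in> H \<Longrightarrow> c \<odot>\<^bsub>dual S \<F>\<^esub> \<phi> \<in> H"
    using H by (auto simp: subsemimodule_def)
  note sumH = subsemimodule_finsum[OF dual_semimodule[OF free_semimodule] H]
  have eqI: "\<psi> = finsum (dual S \<F>) b A"
    if A: "finite A" "b \<in> A \<rightarrow> H" and eq: "\<And>w. w \<in> carrier \<F> \<Longrightarrow> \<psi> w = (\<Oplus>m\<in>A. b m w)" for b A
  proof (rule extensionalityI[of _ "carrier \<F>"])
    show "\<psi> \<in> extensional (carrier \<F>)" using \<psi> by (simp add: mem_dual_iff)
    show "finsum (dual S \<F>) b A \<in> extensional (carrier \<F>)"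
      using sumH[OF A] Hsub by (auto simp: mem_dual_iff)
    fix w assume w: "w \<in> carrier \<F>"
    have "b \<in> A \<rightarrow> carrier (dual S \<F>)" using A(2) Hsub by blast
    then show "\<psi> w = finsum (dual S \<F>) b A w"
      using eq[OF w] finsum_dual[OF free_semimodule w A(1)] by simp
  qed
  show "\<psi> \<in> H"
  proof (cases "E = {}")
    case True
    let ?b = "\<lambda>m. a m \<odot>\<^bsub>dual S \<F>\<^esub> coord S M p m"
    have b: "?b \<in> ?N \<rightarrow> H" using coordH Hsmult a True by blast
    have "\<psi> = finsum (dual S \<F>) ?b ?N"
    proof (rule eqI[OF N b])
      fix w assume w: "w \<in> carrier \<F>"
      then show "\<psi> w = (\<Oplus>m\<in>?N. ?b m w)"
        using expand[OF w] by (simp add: dual_simps coord_def)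
    qed
    then show ?thesis using sumH[OF N b] by simp
  next
    case False
    have "finite E" using N by (rule finite_subset[rotated]) (auto simp: supp_def)
    moreover have "(\<lambda>m. a m \<otimes> f m) ` E \<subseteq> carrier S" using a supp_coeff(2) by auto
    ultimately obtain q where q: "q \<in> E" and max: "\<And>m. m \<in> E \<Longrightarrow> a m \<otimes> f m \<preceq> a q \<otimes> f q"
      using False finite_has_nle_maximum[of "(\<lambda>m. a m \<otimes> f m) ` E"] by auto
    note q_coeff = supp_coeff[OF q]
    let ?N' = "?N - {q}"
    have N': "finite ?N'" "q \<notin> ?N'" "?N = insert q ?N'" using N q_coeff(1) by auto
    have fm: "f m \<in> carrier S" if "m \<in> ?N'" for m
      using free_coeff_closed[OF f, of m] that by simp
    have split: "(\<Oplus>m\<in>?N. a m \<otimes> w m) = a q \<otimes> w q \<oplus> (\<Oplus>m\<in>?N'. a m \<otimes> w m)"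
      if "w \<in> carrier \<F>" for w
      by (subst N'(3), rule finsum_insert)
         (use N' q_coeff(1) a free_coeff_closed[OF that] in auto)
    have sum_f: "(\<Oplus>m\<in>?N'. a m \<otimes> f m) = a q \<otimes> f q"
    proof -
      let ?s = "\<Oplus>m\<in>?N'. a m \<otimes> f m"
      have s: "?s \<in> carrier S" using a fm by (intro finsum_closed) auto
      have d: "delete_term S f q \<in> carrier \<F>" by (rule delete_term_closed[OF f q_coeff(1)])
      have "?s = (\<Oplus>m\<in>?N'. a m \<otimes> delete_term S f q m)"
        using a fm by (intro finsum_cong') (auto simp: delete_term_def)
      also have "\<dots> = \<psi> (delete_term S f q)"
        unfolding expand[OF d] split[OF d] using a s calculation by (simp add: delete_term_def)
      also have "\<dots> = \<psi> f" using bends[OF q] by simp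
      also have "\<dots> = ?s \<oplus> a q \<otimes> f q"
        unfolding expand[OF f] split[OF f] using a s q_coeff(2) by (simp add: a_comm)
      also have "\<dots> = a q \<otimes> f q"
      proof (rule finsum_nle[OF N'(1)])
        fix m assume m: "m \<in> ?N'"
        show "a m \<otimes> f m \<preceq> a q \<otimes> f q"
        proof (cases "m \<in> E")
          case False
          then have "f m = \<zero>" using m by (auto simp: supp_def)
          then show ?thesis using a q_coeff(2) by simp
        qed (rule max)
      qed (use a fm q_coeff(2) in auto)
      finally show ?thesis .
    qed
    \<comment> \<open>No summand at \<open>q\<close>: each \<open>pair m q\<close> contributes to the coefficient at \<open>q\<close>.\<close>
    let ?b = "\<lambda>m. if m \<in> E then (a m \<otimes> f m) \<odot>\<^bsub>dual S \<F>\<^esub> pair m q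
      else a m \<odot>\<^bsub>dual S \<F>\<^esub> coord S M p m"
    have b: "?b \<in> ?N' \<rightarrow> H"
    proof
      fix m assume m: "m \<in> ?N'"
      show "?b m \<in> H"
        using m a fm[OF m] q coordH[of m] pairH[of m q] by (cases "m \<in> E") (simp_all add: Hsmult)
    qed
    have "\<psi> = finsum (dual S \<F>) ?b ?N'"
    proof (rule eqI[OF N'(1) b])
      fix w assume w: "w \<in> carrier \<F>"
      let ?c = "inv f q \<otimes> w q"
      have wm: "w m \<in> carrier S" if "m \<in> ?N'" for m
        using free_coeff_closed[OF w, of m] that by simp
      have wq: "w q \<in> carrier S" by (rule supp_coeff_closed[OF w q])
      have c: "?c \<in> carrier S" using wq q_coeff by simp
      have bm: "?b m w = a m \<otimes> w m \<oplus> (a m \<otimes> f m) \<otimes> ?c" if m: "m \<in> ?N'" for m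
      proof (cases "m \<in> E")
        case True
        have "?b m w = (a m \<otimes> f m) \<otimes> (inv f m \<otimes> w m \<oplus> ?c)"
          using w True by (simp add: dual_simps pair_form_def)
        also have "\<dots> = a m \<otimes> (f m \<otimes> (inv f m \<otimes> w m)) \<oplus> (a m \<otimes> f m) \<otimes> ?c"
          using a fm[OF m] c wm[OF m] supp_coeff(3)[OF True] by (simp add: r_distr m_assoc)
        finally show ?thesis using supp_cancel(1)[OF True wm[OF m]] by simp
      next
        case False
        then have "f m = \<zero>" using m by (auto simp: supp_def)
        then show ?thesis using False w a c wm[OF m] by (simp add: dual_simps coord_def)
      qed
      have "(\<Oplus>m\<in>?N'. ?b m w) = (\<Oplus>m\<in>?N'. a m \<otimes> w m \<oplus> (a m \<otimes> f m) \<otimes> ?c)"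
        by (rule finsum_cong'[OF refl _ bm]) (use a fm wm c in auto)
      also have "\<dots> = (\<Oplus>m\<in>?N'. a m \<otimes> w m) \<oplus> (\<Oplus>m\<in>?N'. (a m \<otimes> f m) \<otimes> ?c)"
        by (rule finsum_addf) (use a fm wm c in auto)
      also have "(\<Oplus>m\<in>?N'. (a m \<otimes> f m) \<otimes> ?c) = a q \<otimes> f q \<otimes> ?c"
        unfolding sum_f[symmetric] by (rule finsum_ldistr[symmetric]) (use N' a fm c in auto)
      also have "a q \<otimes> f q \<otimes> ?c = a q \<otimes> w q"
        using a q_coeff(2) c supp_cancel(1)[OF q wq] by (simp add: m_assoc)
      also have "(\<Oplus>m\<in>?N'. a m \<otimes> w m) \<oplus> a q \<otimes> w q = \<psi> w"
        unfolding expand[OF w] split[OF w]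
        by (rule a_comm) (use a wm wq in \<open>auto intro!: finsum_closed\<close>)
      finally show "\<psi> w = (\<Oplus>m\<in>?N'. ?b m w)" by simp
    qed
    then show ?thesis using sumH[OF N'(1) b] by simp
  qed
qed

lemma bend_congruence_intros:
  shows "(u, v) \<in> \<J> \<Longrightarrow> (v, u) \<in> \<J>"
    and "(u, v) \<in> \<J> \<Longrightarrow> (v, w) \<in> \<J> \<Longrightarrow> (u, w) \<in> \<J>"
    and "v \<in> carrier \<F> \<Longrightarrow> (v, v) \<in> \<J>"
    and "(u, u') \<in> \<J> \<Longrightarrow> (v, v') \<in> \<J> \<Longrightarrow> (u \<oplus>\<^bsub>\<F>\<^esub> v, u' \<oplus>\<^bsub>\<F>\<^esub> v') \<in> \<J>"
    and "a \<in> carrier S \<Longrightarrow> (u, u') \<in> \<J> \<Longrightarrow> (a \<odot>\<^bsub>\<F>\<^esub> u, a \<odot>\<^bsub>\<F>\<^esub> u') \<in> \<J>"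
proof -
  have "refl_on (carrier \<F>) \<J>" "sym \<J>" "trans \<J>"
    using bend_congruence_equiv[OF f] by (simp_all add: equiv_def)
  then show "(u, v) \<in> \<J> \<Longrightarrow> (v, u) \<in> \<J>"
    and "(u, v) \<in> \<J> \<Longrightarrow> (v, w) \<in> \<J> \<Longrightarrow> (u, w) \<in> \<J>"
    and "v \<in> carrier \<F> \<Longrightarrow> (v, v) \<in> \<J>"
    by (blast dest: symD transD refl_onD)+
  have sub: "subsemimodule S (prod_semimodule \<F> \<F>) \<J>"
    using bend_congruence(1)[OF f] by (simp add: semimodule_congruence_def)
  then have "\<forall>P\<in>\<J>. \<forall>R\<in>\<J>. P \<oplus>\<^bsub>prod_semimodule \<F> \<F>\<^esub> R \<in> \<J>"
    and "\<forall>a\<in>carrier S. \<forall>P\<in>\<J>. a \<odot>\<^bsub>prod_semimodule \<F> \<F>\<^esub> P \<in> \<J>"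
    unfolding subsemimodule_def by blast+
  then show "(u, u') \<in> \<J> \<Longrightarrow> (v, v') \<in> \<J> \<Longrightarrow> (u \<oplus>\<^bsub>\<F>\<^esub> v, u' \<oplus>\<^bsub>\<F>\<^esub> v') \<in> \<J>"
    and "a \<in> carrier S \<Longrightarrow> (u, u') \<in> \<J> \<Longrightarrow> (a \<odot>\<^bsub>\<F>\<^esub> u, a \<odot>\<^bsub>\<F>\<^esub> u') \<in> \<J>"
    by (force simp: prod_semimodule_def)+
qed

text \<open>The sum \<open>v + c f\<close> is congruent to \<open>v + c f'\<close>, where \<open>f'\<close> is \<open>f\<close> without its \<open>i\<close>-term, and the latter is
  \<open>v\<close> by the bounds.  So a coordinate can be raised freely as long as it stays, after rescaling,
  below the other coordinates in the support.\<close>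

lemma add_multiple_bend:
  assumes v: "v \<in> carrier \<F>" and i: "i \<in> E" and c: "c \<in> carrier S"
    and le: "\<And>j. j \<in> E \<Longrightarrow> j \<noteq> i \<Longrightarrow> c \<otimes> f j \<preceq> v j"
  shows "(v \<oplus>\<^bsub>\<F>\<^esub> c \<odot>\<^bsub>\<F>\<^esub> f, v) \<in> \<J>"
proof -
  interpret F: semimodule S \<F> by (rule free_semimodule)
  let ?d = "delete_term S f i"
  have d: "?d \<in> carrier \<F>" by (rule delete_term_closed[OF f supp_coeff(1)[OF i]])
  have "(f, ?d) \<in> \<J>" using bend_congruence(2)[OF f] i by (auto simp: bend_relations_def)
  then have "(c \<odot>\<^bsub>\<F>\<^esub> f, c \<odot>\<^bsub>\<F>\<^esub> ?d) \<in> \<J>"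
    by (rule bend_congruence_intros(5)[OF c])
  then have "(v \<oplus>\<^bsub>\<F>\<^esub> c \<odot>\<^bsub>\<F>\<^esub> f, v \<oplus>\<^bsub>\<F>\<^esub> c \<odot>\<^bsub>\<F>\<^esub> ?d) \<in> \<J>"
    by (rule bend_congruence_intros(4)[OF bend_congruence_intros(3)[OF v]])
  moreover have "v \<oplus>\<^bsub>\<F>\<^esub> c \<odot>\<^bsub>\<F>\<^esub> ?d = v"
  proof (rule free_eqI)
    show "v \<oplus>\<^bsub>\<F>\<^esub> c \<odot>\<^bsub>\<F>\<^esub> ?d \<in> carrier \<F>" using v c d F.smult_closed by simp
    fix m assume m: "m \<in> M - {p}"
    have cl: "v m \<in> carrier S" "f m \<in> carrier S"
      by (rule free_coeff_closed[OF v m] free_coeff_closed[OF f m])+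
    have "c \<otimes> ?d m \<preceq> v m"
    proof (cases "m \<in> E \<and> m \<noteq> i")
      case True
      then show ?thesis using le[of m] by (simp add: delete_term_def)
    next
      case False
      then have "?d m = \<zero>" using m by (auto simp: delete_term_def supp_def)
      then show ?thesis using c cl by simp
    qed
    moreover have "?d m \<in> carrier S" using free_coeff_closed[OF d m] .
    ultimately show "(v \<oplus>\<^bsub>\<F>\<^esub> c \<odot>\<^bsub>\<F>\<^esub> ?d) m = v m"
      using c cl by (simp only: free_coeff[OF m] a_comm[of "v m"] m_closed)
  qed (rule v)
  ultimately show ?thesis by simp
qed

text \<open>Let \<open>x\<close> and \<open>y\<close> be the rescaled coordinates.  If \<open>y\<^sub>i > x\<^sub>i\<close>, then
  \<open>x\<^sub>i + x\<^sub>j = y\<^sub>i + y\<^sub>j > x\<^sub>i\<close> for every other \<open>j\<close> in the support, so this sum is \<open>x\<^sub>j\<close> and bounds both \<open>y\<^sub>i\<close>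
  and \<open>y\<^sub>j\<close>.  Thus passing from \<open>v\<close> to \<open>v + w\<close> only raises the coordinate \<open>i\<close>, in the way that the
  congruence allows.  If there is no such \<open>i\<close>, then \<open>v + w = v\<close>.\<close>

lemma add_congruent_if_bend_forms_agree:
  assumes v: "v \<in> carrier \<F>" and w: "w \<in> carrier \<F>"
    and agree: "\<And>\<psi>. \<psi> \<in> carrier B \<Longrightarrow> \<psi> v = \<psi> w"
  shows "(v \<oplus>\<^bsub>\<F>\<^esub> w, v) \<in> \<J>"
proof -
  interpret F: semimodule S \<F> by (rule free_semimodule)
  define x where "x i = inv f i \<otimes> v i" for i
  define y where "y i = inv f i \<otimes> w i" for i
  have x: "x i \<in> carrier S" "v i = f i \<otimes> x i" if "i \<in> E" for i
    using supp_coeff[OF that] supp_coeff_closed[OF v that] supp_cancel[OF that]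
    by (simp_all add: x_def)
  have y: "y i \<in> carrier S" "w i = f i \<otimes> y i" if "i \<in> E" for i
    using supp_coeff[OF that] supp_coeff_closed[OF w that] supp_cancel[OF that]
    by (simp_all add: y_def)
  have off: "v m = w m" if "m \<in> M - {p}" "m \<notin> E" for m
    using agree[OF coord_in_bend[OF that]] v w by (simp add: coord_def)
  have on: "x i \<oplus> x j = y i \<oplus> y j" if "i \<in> E" "j \<in> E" "i \<noteq> j" for i j
    using agree[OF pair_form_in_bend[OF that]] v w by (simp add: pair_form_def x_def y_def)
  have scale: "f i \<otimes> b \<preceq> f i \<otimes> c" if "i \<in> E" "b \<in> carrier S" "c \<in> carrier S" "b \<preceq> c" for i b c
    using that supp_coeff(2)[OF that(1)] by (simp add: r_distr[symmetric])
  show ?thesis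
  proof (cases "\<exists>i\<in>E. \<not> y i \<preceq> x i")
    case True
    then obtain i where i: "i \<in> E" "\<not> y i \<preceq> x i" by blast
    have le: "y i \<preceq> x j \<and> y j \<preceq> x j" if j: "j \<in> E" "j \<noteq> i" for j
    proof -
      note cl = x(1)[OF i(1)] y(1)[OF i(1)] x(1)[OF j(1)] y(1)[OF j(1)]
      have eq: "x i \<oplus> x j = y i \<oplus> y j" using on i j by blast
      have yi: "y i \<preceq> x i \<oplus> x j"
        unfolding eq using cl by (simp add: a_assoc[symmetric] add_idem)
      have "x i \<preceq> x j"
      proof (rule ccontr)
        assume "\<not> x i \<preceq> x j"
        then have "x i \<oplus> x j = x i" using nle_linear[of "x i" "x j"] cl a_comm by metis
        with yi i(2) show False by simp
      qed
      moreover have "y j \<preceq> x i \<oplus> x j"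
        unfolding eq using cl by (simp add: a_lcomm add_idem)
      ultimately show ?thesis using yi by simp
    qed
    have "v \<oplus>\<^bsub>\<F>\<^esub> w = v \<oplus>\<^bsub>\<F>\<^esub> y i \<odot>\<^bsub>\<F>\<^esub> f"
    proof (rule free_eqI)
      show "v \<oplus>\<^bsub>\<F>\<^esub> w \<in> carrier \<F>" "v \<oplus>\<^bsub>\<F>\<^esub> y i \<odot>\<^bsub>\<F>\<^esub> f \<in> carrier \<F>"
        using v w f y(1)[OF i(1)] F.smult_closed by simp_all
      fix m assume m: "m \<in> M - {p}"
      have cl: "v m \<in> carrier S" "w m \<in> carrier S" "f m \<in> carrier S"
        by (rule free_coeff_closed[OF v m] free_coeff_closed[OF w m] free_coeff_closed[OF f m])+
      have "v m \<oplus> w m = v m \<oplus> y i \<otimes> f m"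
      proof (cases "m \<in> E")
        case mE: True
        show ?thesis
        proof (cases "m = i")
          case True
          then show ?thesis using y[OF i(1)] cl by (simp add: m_comm)
        next
          case False
          note l = le[OF mE False]
          have "w m \<preceq> v m"
            unfolding x(2)[OF mE] y(2)[OF mE] using l x(1)[OF mE] y(1)[OF mE] scale[OF mE] by blast
          moreover have "f m \<otimes> y i \<preceq> v m"
            unfolding x(2)[OF mE] using l x(1)[OF mE] y(1)[OF i(1)] scale[OF mE] by blast
          ultimately show ?thesis
            using cl y(1)[OF i(1)] by (simp add: a_comm[of "v m"] m_comm[of "y i"])
        qed
      next
        case False
        then have "f m = \<zero>" using m by (auto simp: supp_def)
        then show ?thesis using off[OF m False] cl y(1)[OF i(1)] by (simp add: add_idem)
      qed
      then show "(v \<oplus>\<^bsub>\<F>\<^esub> w) m = (v \<oplus>\<^bsub>\<F>\<^esub> y i \<odot>\<^bsub>\<F>\<^esub> f) m"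
        by (simp only: free_coeff[OF m])
    qed
    moreover have "(v \<oplus>\<^bsub>\<F>\<^esub> y i \<odot>\<^bsub>\<F>\<^esub> f, v) \<in> \<J>"
    proof (rule add_multiple_bend[OF v i(1) y(1)[OF i(1)]])
      fix j assume j: "j \<in> E" "j \<noteq> i"
      have "f j \<otimes> y i \<preceq> f j \<otimes> x j"
        using scale[OF j(1) y(1)[OF i(1)] x(1)[OF j(1)]] le[OF j] by blast
      then show "y i \<otimes> f j \<preceq> v j"
        using x[OF j(1)] y(1)[OF i(1)] supp_coeff(2)[OF j(1)] by (simp add: m_comm[of "y i"])
    qed
    ultimately show ?thesis by simp
  next
    case False
    have "v \<oplus>\<^bsub>\<F>\<^esub> w = v"
    proof (rule free_eqI)
      fix m assume m: "m \<in> M - {p}"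
      have cl: "v m \<in> carrier S" "w m \<in> carrier S"
        by (rule free_coeff_closed[OF v m] free_coeff_closed[OF w m])+
      have "w m \<preceq> v m"
      proof (cases "m \<in> E")
        case mE: True
        show ?thesis
          unfolding x(2)[OF mE] y(2)[OF mE]
          using False mE x(1)[OF mE] y(1)[OF mE] scale[OF mE] by blast
      qed (use off[OF m] cl add_idem in simp)
      then show "(v \<oplus>\<^bsub>\<F>\<^esub> w) m = v m"
        using cl by (simp only: free_coeff[OF m] a_comm[of "v m"])
    qed (use v w in simp_all)
    then show ?thesis using bend_congruence_intros(3)[OF v] by simp
  qed
qed

lemma bend_forms_separate:
  assumes v: "v \<in> carrier \<F>" and w: "w \<in> carrier \<F>"
    and agree: "\<And>\<psi>. \<psi> \<in> carrier B \<Longrightarrow> \<psi> v = \<psi> w"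
  shows "(v, w) \<in> \<J>"
proof -
  interpret F: semimodule S \<F> by (rule free_semimodule)
  have "(v \<oplus>\<^bsub>\<F>\<^esub> w, v) \<in> \<J>"
    using add_congruent_if_bend_forms_agree[OF v w agree] .
  moreover have "(v \<oplus>\<^bsub>\<F>\<^esub> w, w) \<in> \<J>"
    using add_congruent_if_bend_forms_agree[OF w v agree[symmetric]] v w
    by (simp add: F.V.a_comm)
  ultimately show ?thesis using bend_congruence_intros(1,2) by blast
qed

text \<open>On the generators, the values of an evaluation at rescaled coordinates \<open>u\<close> are
  \<open>u\<^sub>i + u\<^sub>j\<close>, so \<open>u\<^sub>i\<close> can be at most \<open>\<Phi> (pair i j)\<close> for every \<open>j \<noteq> i\<close>.  The
  largest choice, the minimum of these values, works: the generators satisfy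
  \<open>pair i j \<le> pair i k + pair j l\<close>, and \<open>\<Phi>\<close> is monotone.\<close>

lemma bend_dual_form_is_evaluation:
  assumes \<Phi>: "\<Phi> \<in> carrier (dual S B)"
  shows "\<exists>v\<in>carrier \<F>. \<forall>\<psi>\<in>carrier B. \<Phi> \<psi> = \<psi> v"
proof -
  have \<Phi>_closed: "\<Phi> \<psi> \<in> carrier S" if "\<psi> \<in> carrier B" for \<psi>
    using \<Phi> that by (simp add: mem_dual_iff)
  have \<Phi>_zero: "\<Phi> \<zero>\<^bsub>dual S \<F>\<^esub> = \<zero>"
    using \<Phi> by (simp add: mem_dual_iff bend_simps[OF f])
  have \<Phi>_add: "\<Phi> (\<phi> \<oplus>\<^bsub>dual S \<F>\<^esub> \<psi>) = \<Phi> \<phi> \<oplus> \<Phi> \<psi>" if "\<phi> \<in> carrier B" "\<psi> \<in> carrier B" for \<phi> \<psi>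
    using \<Phi> that by (simp add: mem_dual_iff bend_simps[OF f])
  have \<Phi>_smult: "\<Phi> (a \<odot>\<^bsub>dual S \<F>\<^esub> \<psi>) = a \<otimes> \<Phi> \<psi>" if "a \<in> carrier S" "\<psi> \<in> carrier B" for a \<psi>
    using \<Phi> that by (simp add: mem_dual_iff bend_simps[OF f])
  \<comment> \<open>If \<open>E = {i}\<close>, all forms of the bend locus ignore the coordinate \<open>i\<close>, and any value is correct.\<close>
  define row_min where "row_min i c \<longleftrightarrow> c \<in> carrier S \<and> (\<forall>j\<in>E - {i}. c \<preceq> \<Phi> (pair i j)) \<and>
      (E - {i} = {} \<or> c \<in> (\<lambda>j. \<Phi> (pair i j)) ` (E - {i}))" for i c
  have "\<exists>c. row_min i c" if i: "i \<in> E" for i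
  proof (cases "E - {i} = {}")
    case False
    have "finite E" using finite_M by (rule finite_subset[rotated]) (auto simp: supp_def)
    moreover have sub: "(\<lambda>j. \<Phi> (pair i j)) ` (E - {i}) \<subseteq> carrier S"
      using \<Phi>_closed pair_form_in_bend[OF i] by auto
    ultimately obtain c where "c \<in> (\<lambda>j. \<Phi> (pair i j)) ` (E - {i})"
      "\<forall>t\<in>(\<lambda>j. \<Phi> (pair i j)) ` (E - {i}). c \<preceq> t"
      using finite_has_nle_minimum[of "(\<lambda>j. \<Phi> (pair i j)) ` (E - {i})"] False by blast
    then have "row_min i c" using sub unfolding row_min_def by blast
    then show ?thesis ..
  next
    case True
    then have "row_min i \<zero>" unfolding row_min_def by (simp only: True) simp
    then show ?thesis ..
  qed
  then have "\<forall>i\<in>E. \<exists>c. row_min i c" by blast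
  from bchoice[OF this] obtain u where row_min: "\<And>i. i \<in> E \<Longrightarrow> row_min i (u i)"
    by blast
  have u: "u i \<in> carrier S" if "i \<in> E" for i
    using row_min[OF that] by (simp add: row_min_def)
  have u_le: "u i \<preceq> \<Phi> (pair i j)" if "i \<in> E" "j \<in> E - {i}" for i j
    using row_min[OF that(1)] that(2) by (simp add: row_min_def)
  have u_attained: "\<exists>k\<in>E - {i}. u i = \<Phi> (pair i k)" if "i \<in> E" "j \<in> E - {i}" for i j
    using row_min[OF that(1)] that(2) by (auto simp: row_min_def)
  define v where "v = (\<lambda>m\<in>M - {p}. if m \<in> E then f m \<otimes> u m else \<Phi> (coord S M p m))"
  have v: "v \<in> carrier \<F>"
    using u supp_coeff(2) \<Phi>_closed coord_in_bend by (auto simp: v_def free_carrier[OF finite_M])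
  have pair_comm: "pair i j = pair j i" if "i \<in> E" "j \<in> E" for i j
    unfolding pair_form_def using supp_coeff(3) supp_coeff_closed that
    by (intro restrict_ext a_comm) auto
  have pair_v: "\<Phi> (pair i j) = pair i j v" if ij: "i \<in> E" "j \<in> E" "i \<noteq> j" for i j
  proof -
    obtain k where k: "k \<in> E" "k \<noteq> i" "u i = \<Phi> (pair i k)"
      using u_attained[of i j] ij by blast
    obtain l where l: "l \<in> E" "l \<noteq> j" "u j = \<Phi> (pair j l)"
      using u_attained[of j i] ij by blast
    have B: "pair i j \<in> carrier B" "pair i k \<in> carrier B" "pair j l \<in> carrier B"
      using pair_form_in_bend ij k l by blast+
    note cl = \<Phi>_closed[OF B(1)] u[OF ij(1)] u[OF ij(2)]
    have "pair i j \<oplus>\<^bsub>dual S \<F>\<^esub> (pair i k \<oplus>\<^bsub>dual S \<F>\<^esub> pair j l) = pair i k \<oplus>\<^bsub>dual S \<F>\<^esub> pair j l"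
      unfolding dual_simps
    proof (rule restrict_ext)
      fix w assume w: "w \<in> carrier \<F>"
      have c: "inv f n \<otimes> w n \<in> carrier S" if "n \<in> E" for n
        using supp_coeff(3)[OF that] supp_coeff_closed[OF w that] by simp
      have idem: "a \<oplus> b \<oplus> (a \<oplus> c \<oplus> (b \<oplus> d)) = a \<oplus> c \<oplus> (b \<oplus> d)"
        if "a \<in> carrier S" "b \<in> carrier S" "c \<in> carrier S" "d \<in> carrier S" for a b c d
        using that by (simp add: a_ac add_left_idem)
      show "pair i j w \<oplus> (\<lambda>x\<in>carrier \<F>. pair i k x \<oplus> pair j l x) w = pair i k w \<oplus> pair j l w"
        using w idem c ij k l by (simp add: pair_form_def)
    qed
    from arg_cong[OF this, of \<Phi>] have "\<Phi> (pair i j) \<preceq> u i \<oplus> u j"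
      unfolding k(3) l(3) using B bend_closed(2)[OF f] by (simp only: \<Phi>_add)
    moreover have "u i \<oplus> u j \<preceq> \<Phi> (pair i j)"
    proof -
      have "u i \<preceq> \<Phi> (pair i j)" "u j \<preceq> \<Phi> (pair i j)"
        using u_le[of i j] u_le[of j i] pair_comm[OF ij(1,2)] ij by auto
      then show ?thesis using cl by (simp add: a_assoc)
    qed
    ultimately have "\<Phi> (pair i j) = u i \<oplus> u j"
      using a_comm[OF cl(1) a_closed[OF cl(2,3)]] by simp
    also have "\<dots> = pair i j v"
      using v ij u supp_coeff(1) supp_cancel(2) by (simp add: pair_form_def v_def)
    finally show ?thesis .
  qed
  have form: "\<psi> \<in> carrier (dual S \<F>)" if "\<psi> \<in> carrier B" for \<psi>
    using that by (simp add: mem_bend_iff[OF f])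
  let ?H = "{\<psi> \<in> carrier B. \<Phi> \<psi> = \<psi> v}"
  have "carrier B \<subseteq> ?H"
  proof (rule bend_generated)
    show "subsemimodule S (dual S \<F>) ?H"
      unfolding subsemimodule_def
    proof (intro conjI ballI subsetI)
      show "\<zero>\<^bsub>dual S \<F>\<^esub> \<in> ?H"
        using bend_closed(1)[OF f] \<Phi>_zero v by (simp add: dual_simps)
      fix \<phi> assume \<phi>: "\<phi> \<in> ?H"
      then show "\<phi> \<in> carrier (dual S \<F>)" using form by blast
      show "\<phi> \<oplus>\<^bsub>dual S \<F>\<^esub> \<psi> \<in> ?H" if "\<psi> \<in> ?H" for \<psi>
        using \<phi> that bend_closed(2)[OF f, of \<phi> \<psi>] \<Phi>_add[of \<phi> \<psi>] v by (simp add: dual_simps)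
      show "a \<odot>\<^bsub>dual S \<F>\<^esub> \<phi> \<in> ?H" if "a \<in> carrier S" for a
        using \<phi> that bend_closed(3)[OF f, of a \<phi>] \<Phi>_smult[of a \<phi>] v by (simp add: dual_simps)
    qed
    show "coord S M p m \<in> ?H" if "m \<in> M - {p}" "m \<notin> E" for m
      using coord_in_bend[OF that] that v by (simp add: coord_def v_def)
    show "pair i j \<in> ?H" if "i \<in> E" "j \<in> E" "i \<noteq> j" for i j
      using pair_form_in_bend[OF that] pair_v[OF that] by simp
  qed
  then have "\<forall>\<psi>\<in>carrier B. \<Phi> \<psi> = \<psi> v" by (simp add: subset_iff)
  then show ?thesis using v by (rule bexI)
qed

lemma bend_evaluation_iso:
  "bend_evaluation S M p f \<in> semimodule_iso S \<Q> (dual S B)"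
proof -
  let ?h = "bend_evaluation S M p f"
  have hom: "?h \<in> semimodule_hom S \<Q> (dual S B)" by (rule bend_evaluation_hom[OF f])
  have "inj_on ?h (carrier \<Q>)"
  proof (rule inj_onI)
    fix X Y assume X: "X \<in> carrier \<Q>" and Y: "Y \<in> carrier \<Q>" and eq: "?h X = ?h Y"
    from X obtain v where v: "v \<in> carrier \<F>" "X = \<J> `` {v}" by (rule bend_class_rep[OF f])
    from Y obtain w where w: "w \<in> carrier \<F>" "Y = \<J> `` {w}" by (rule bend_class_rep[OF f])
    have "\<psi> v = \<psi> w" if "\<psi> \<in> carrier B" for \<psi>
      using fun_cong[OF eq, of \<psi>] that
      unfolding v(2) w(2) bend_evaluation_class[OF f v(1)] bend_evaluation_class[OF f w(1)]
      by simp
    then have "(v, w) \<in> \<J>" by (rule bend_forms_separate[OF v(1) w(1)])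
    then show "X = Y"
      unfolding v(2) w(2) by (rule equiv_class_eq[OF bend_congruence_equiv[OF f]])
  qed
  moreover have "\<Phi> \<in> ?h ` carrier \<Q>" if \<Phi>: "\<Phi> \<in> carrier (dual S B)" for \<Phi>
  proof -
    obtain v where v: "v \<in> carrier \<F>" "\<forall>\<psi>\<in>carrier B. \<Phi> \<psi> = \<psi> v"
      using bend_dual_form_is_evaluation[OF \<Phi>] by blast
    have "\<Phi> = ?h (\<J> `` {v})"
      unfolding bend_evaluation_class[OF f v(1)]
      using \<Phi> v(2) by (intro extensionalityI[of _ "carrier B"]) (auto simp: mem_dual_iff)
    then show ?thesis using bend_class_closed[OF f v(1)] by blast
  qed
  ultimately show ?thesis
    using hom by (auto simp: semimodule_iso_def bij_betw_def semimodule_hom_def)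
qed

text \<open>Evaluating \<open>\<phi>\<close> at a class is the same as evaluating its pullback in the bend locus there, so
  the double dual map is \<open>bend_evaluation\<close> transported along \<open>bend_pullback\<close>.\<close>

lemma double_dual_map_iso:
  "double_dual_map S \<Q> \<in> semimodule_iso S \<Q> (dual S (dual S \<Q>))"
proof -
  let ?T = "\<lambda>\<Phi>. \<lambda>\<phi>\<in>carrier (dual S \<Q>). \<Phi> (bend_pullback S M p f \<phi>)"
  note quot = bend_quotient_semimodule[OF f]
  have "?T \<in> semimodule_iso S (dual S B) (dual S (dual S \<Q>))"
    by (rule transpose_iso[OF dual_semimodule[OF quot] bend_pullback_iso[OF f]])
  then have "?T \<circ> bend_evaluation S M p f \<in> semimodule_iso S \<Q> (dual S (dual S \<Q>))"
    by (rule semimodule_iso_comp[OF bend_evaluation_iso])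
  then show ?thesis
    by (rule semimodule_iso_cong[OF quot])
       (auto simp: double_dual_map_def bend_evaluation_pullback[OF f])
qed

end

end

theorem theorem5p2p2:
  fixes S :: "('a, 'x) ring_scheme" and M :: "'m set" and p :: 'm and f :: "'m \<Rightarrow> 'a"
  assumes "totally_ordered_idempotent_semifield S"
    and "finite M" and "p \<in> M"
    and "f \<in> carrier (free_semimodule S M p)"
  shows "double_dual_map S (bend_quotient S M p f)
           \<in> semimodule_iso S (bend_quotient S M p f) (dual S (dual S (bend_quotient S M p f)))
       \<and> bend_evaluation S M p f
           \<in> semimodule_iso S (bend_quotient S M p f) (dual S (bend S M p f))"
  using totally_ordered_idempotent_semifield.double_dual_map_iso[OF assms(1,2,4)]
    totally_ordered_idempotent_semifield.bend_evaluation_iso[OF assms(1,2,4)]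
  by blast

end
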